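(* Let $\varphi_1,\ldots,\varphi_m\in\mathbb{Q}(X)$ be non-zero multiplicatively independent rational functions. Then there are two effectively computable constants $c_1,c_2$ depending only on $\varphi_1,\ldots,\varphi_m$ such that, as $N\to\infty$, for all but $c_1N(\log N)^{-2}$ primes $p\le N$ and for all but at most $c_2$ elements $\alpha\in\overline{\mathbb{F}}_p$, at least $m-1$ of the elements $\varphi_1(\alpha),\ldots,\varphi_m(\alpha)$ have multiplicative order at least $(N/\log N)^{1/(2m+2)}$.
   Context: Non-zero rational functions are multiplicatively independent if no non-trivial product of integer powers of them equals $1$. For $f\in\mathbb{Q}(X)$ and $\alpha\in\overline{\mathbb{F}}_p$, $f(\alpha)$ denotes the value at $\alpha$ of the reduction of $f$ modulo $p$; primes for which a reduction is undefined are excluded, and zeros and poles of the reduced functions are excluded. *)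

theory Defs
  imports
    Complex_Main
    "HOL-Number_Theory.Residues"
    "HOL-Algebra.Algebraic_Closure"
    "HOL-Library.Nat_Bijection"
    "HOL-Computational_Algebra.Computational_Algebra"
    "HOL-Computational_Algebra.Field_as_Ring"
begin

type_synonym ratfun = "rat poly fract"

text \<open>Integer exponents may be negative, so this is independence in the multiplicative group
  of \<open>\<rat>(X)\<close>; it is only meaningful for non-zero functions.\<close>

definition mult_independent :: "ratfun list \<Rightarrow> bool" where
  "mult_independent fs \<longleftrightarrow>
     (\<forall>k :: nat \<Rightarrow> int. (\<Prod>i<length fs. (fs ! i) powi (k i)) = 1 \<longrightarrow> (\<forall>i<length fs. k i = 0))"


subsection \<open>Effective computability\<close>

text \<open>
  The total recursive functions of arity \<open>k\<close>, an argument tuple being a list of length \<open>k\<close>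
  (values on lists of other lengths are irrelevant).  Minimisation is only applied to functions
  that have a zero for every choice of parameters, so that all functions in the class are total.
\<close>

inductive recursive_fun :: "nat \<Rightarrow> (nat list \<Rightarrow> nat) \<Rightarrow> bool" where
  zero: "recursive_fun k (\<lambda>xs. 0)"
| succ: "recursive_fun 1 (\<lambda>xs. Suc (xs ! 0))"
| proj: "i < k \<Longrightarrow> recursive_fun k (\<lambda>xs. xs ! i)"
| comp: "recursive_fun (length gs) f \<Longrightarrow> (\<forall>g\<in>set gs. recursive_fun k g) \<Longrightarrow>
           recursive_fun k (\<lambda>xs. f (map (\<lambda>g. g xs) gs))"
| prec: "recursive_fun k f \<Longrightarrow> recursive_fun (Suc (Suc k)) g \<Longrightarrow>
           recursive_fun (Suc k) (\<lambda>xs. rec_nat (f (tl xs)) (\<lambda>n r. g (n # r # tl xs)) (hd xs))"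
| mini: "recursive_fun (Suc k) f \<Longrightarrow> (\<forall>xs. length xs = k \<longrightarrow> (\<exists>y. f (y # xs) = 0)) \<Longrightarrow>
           recursive_fun k (\<lambda>xs. LEAST y. f (y # xs) = 0)"

definition rat_code :: "rat \<Rightarrow> nat" where
  "rat_code q = prod_encode (int_encode (fst (quotient_of q)), int_encode (snd (quotient_of q)))"

definition poly_code :: "rat poly \<Rightarrow> nat" where
  "poly_code P = list_encode (map rat_code (coeffs P))"

text \<open>A rational function is coded by its representation in lowest terms with monic denominator.\<close>

definition ratfun_code :: "ratfun \<Rightarrow> nat" where
  "ratfun_code f = prod_encode (poly_code (fst (quot_of_fract f)), poly_code (snd (quot_of_fract f)))"

text \<open>
  A quantity depending on a tuple of rational functions is effectively computable if a recursive
  function computes it from the code of the tuple.  Natural numbers suffice as values for constants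
  that occur only as upper bounds.
\<close>

definition effectively_computable :: "(ratfun list \<Rightarrow> nat) \<Rightarrow> bool" where
  "effectively_computable c \<longleftrightarrow>
     (\<exists>h. recursive_fun 1 h \<and> (\<forall>fs. c fs = h [list_encode (map ratfun_code fs)]))"


subsection \<open>Reduction modulo a prime\<close>

type_synonym fp_elem = "(int list \<times> nat) multiset \<Rightarrow> int"

definition Fp_bar :: "nat \<Rightarrow> fp_elem ring" where
  "Fp_bar p = field.alg_closure (residue_ring (int p))"

definition int_poly_to_ratfun :: "int poly \<Rightarrow> ratfun" where
  "int_poly_to_ratfun A = to_fract (map_poly rat_of_int A)"

text \<open>
  Polynomials over \<open>\<bbbF>\<^sub>p\<close> are represented by integer polynomials, taken modulo the
  constant polynomial \<open>[:int p:]\<close>.  For \<open>f = A / B\<close> with integer polynomials \<open>A\<close>, \<open>B\<close> such that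
  \<open>B\<close> is non-zero modulo \<open>p\<close>, the reduction of \<open>f\<close> is the quotient of the reductions of \<open>A\<close> and \<open>B\<close>.
  The following relation says that this reduction is equal to \<open>U / V\<close> in \<open>\<bbbF>\<^sub>p(X)\<close>.
\<close>

definition reduces_to :: "nat \<Rightarrow> ratfun \<Rightarrow> int poly \<Rightarrow> int poly \<Rightarrow> bool" where
  "reduces_to p f U V \<longleftrightarrow> \<not> [:int p:] dvd V \<and>
     (\<exists>A B. \<not> [:int p:] dvd B \<and> f = int_poly_to_ratfun A / int_poly_to_ratfun B \<and>
            [:int p:] dvd (U * B - A * V))"

definition has_reduction :: "nat \<Rightarrow> ratfun \<Rightarrow> bool" where
  "has_reduction p f \<longleftrightarrow> (\<exists>U V. reduces_to p f U V)"

definition eval_Fp_bar :: "nat \<Rightarrow> int poly \<Rightarrow> fp_elem \<Rightarrow> fp_elem" where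
  "eval_Fp_bar p U a =
     (\<Oplus>\<^bsub>Fp_bar p\<^esub> i\<in>{..Polynomial.degree U}. [Polynomial.coeff U i] \<cdot>\<^bsub>Fp_bar p\<^esub> (a [^]\<^bsub>Fp_bar p\<^esub> i))"

text \<open>
  \<open>U\<close> and \<open>V\<close> may be changed within the class of \<open>U / V\<close> in \<open>\<bbbF>\<^sub>p(X)\<close>, so common zeros of the
  reductions of \<open>A\<close> and \<open>B\<close> above do not count as poles of the reduced function.
\<close>

definition has_value :: "nat \<Rightarrow> ratfun \<Rightarrow> fp_elem \<Rightarrow> fp_elem \<Rightarrow> bool" where
  "has_value p f a v \<longleftrightarrow>
     (\<exists>U V. reduces_to p f U V \<and> eval_Fp_bar p V a \<noteq> \<zero>\<^bsub>Fp_bar p\<^esub> \<and>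
            v = eval_Fp_bar p U a \<otimes>\<^bsub>Fp_bar p\<^esub> inv\<^bsub>Fp_bar p\<^esub> (eval_Fp_bar p V a))"

lemma Fp_bar_field:
  assumes "Factorial_Ring.prime p"
  shows "field (Fp_bar p)" and "[int p] \<cdot>\<^bsub>Fp_bar p\<^esub> \<one>\<^bsub>Fp_bar p\<^esub> = \<zero>\<^bsub>Fp_bar p\<^esub>"
proof -
  have R: "residues_prime p" using assms by unfold_locales simp_all
  have F: "field (residue_ring (int p))" by (rule residues_prime.is_field[OF R])
  interpret F: field "residue_ring (int p)" by (rule F)
  have ac: "algebraic_closure (Fp_bar p) (ring.indexed_const (residue_ring (int p)) ` carrier (residue_ring (int p)))"
    and h: "ring.indexed_const (residue_ring (int p)) \<in> ring_hom (residue_ring (int p)) (Fp_bar p)"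
    using field.alg_closureE[OF F] unfolding Fp_bar_def by auto
  show L: "field (Fp_bar p)" using ac by (simp add: algebraic_closure_def)
  interpret L: field "Fp_bar p" by (rule L)
  let ?h = "ring.indexed_const (residue_ring (int p))"
  interpret H: ring_hom_ring "residue_ring (int p)" "Fp_bar p" ?h
    using h by (intro ring_hom_ringI2) (auto intro: F.ring_axioms L.ring_axioms)
  have "?h ([n] \<cdot>\<^bsub>residue_ring (int p)\<^esub> \<one>\<^bsub>residue_ring (int p)\<^esub>) = [n] \<cdot>\<^bsub>Fp_bar p\<^esub> \<one>\<^bsub>Fp_bar p\<^esub>" for n :: nat
  proof (induction n)
    case (Suc n) then show ?case
      using F.add.nat_pow_closed[of "\<one>\<^bsub>residue_ring (int p)\<^esub>" n] by simp
  qed simp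
  from this[of p] have hom: "?h ([p] \<cdot>\<^bsub>residue_ring (int p)\<^esub> \<one>\<^bsub>residue_ring (int p)\<^esub>) = [p] \<cdot>\<^bsub>Fp_bar p\<^esub> \<one>\<^bsub>Fp_bar p\<^esub>" .
  have proj: "\<one>\<^bsub>residue_ring (int p)\<^esub> = 1" "\<zero>\<^bsub>residue_ring (int p)\<^esub> = 0" "x \<oplus>\<^bsub>residue_ring (int p)\<^esub> y = (x + y) mod int p" for x y
    by (simp_all add: residue_ring_def)
  have "[n] \<cdot>\<^bsub>residue_ring (int p)\<^esub> \<one>\<^bsub>residue_ring (int p)\<^esub> = int n mod int p" for n :: nat
    by (induction n) (simp_all add: proj mod_simps add.commute)
  from this[of p] have "[p] \<cdot>\<^bsub>residue_ring (int p)\<^esub> \<one>\<^bsub>residue_ring (int p)\<^esub> = \<zero>\<^bsub>residue_ring (int p)\<^esub>"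
    by (simp add: proj)
  with hom have "[p] \<cdot>\<^bsub>Fp_bar p\<^esub> \<one>\<^bsub>Fp_bar p\<^esub> = \<zero>\<^bsub>Fp_bar p\<^esub>"
    using H.hom_zero by simp
  then show "[int p] \<cdot>\<^bsub>Fp_bar p\<^esub> \<one>\<^bsub>Fp_bar p\<^esub> = \<zero>\<^bsub>Fp_bar p\<^esub>"
    by (simp add: add_pow_int_ge)
qed

context
  fixes p :: nat and a
  assumes p: "Factorial_Ring.prime p" and a: "a \<in> carrier (Fp_bar p)"
begin

interpretation L: field "Fp_bar p" by (rule Fp_bar_field(1)[OF p])


private lemma int_add_pow_0: "[(0::int)] \<cdot>\<^bsub>Fp_bar p\<^esub> x = \<zero>\<^bsub>Fp_bar p\<^esub>"
  by (simp add: add_pow_int_ge)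

lemma eval_Fp_bar_altdef: "Polynomial.degree U \<le> n \<Longrightarrow>
   eval_Fp_bar p U a = (\<Oplus>\<^bsub>Fp_bar p\<^esub> i\<in>{..n}. [Polynomial.coeff U i] \<cdot>\<^bsub>Fp_bar p\<^esub> (a [^]\<^bsub>Fp_bar p\<^esub> i))"
  unfolding eval_Fp_bar_def using a
  by (intro L.add.finprod_mono_neutral_cong) (auto simp: coeff_eq_0 int_add_pow_0)

lemma eval_Fp_bar_closed: "eval_Fp_bar p U a \<in> carrier (Fp_bar p)"
  unfolding eval_Fp_bar_def using a by (intro L.finsum_closed) auto

lemma eval_Fp_bar_pCons: "eval_Fp_bar p (pCons c U) a = [c] \<cdot>\<^bsub>Fp_bar p\<^esub> \<one>\<^bsub>Fp_bar p\<^esub> \<oplus>\<^bsub>Fp_bar p\<^esub> a \<otimes>\<^bsub>Fp_bar p\<^esub> eval_Fp_bar p U a"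
proof -
  have "eval_Fp_bar p (pCons c U) a = (\<Oplus>\<^bsub>Fp_bar p\<^esub> i\<in>{..Suc (Polynomial.degree U)}. [Polynomial.coeff (pCons c U) i] \<cdot>\<^bsub>Fp_bar p\<^esub> (a [^]\<^bsub>Fp_bar p\<^esub> i))"
    by (rule eval_Fp_bar_altdef) (simp add: degree_pCons_le)
  also have "\<dots> = (\<Oplus>\<^bsub>Fp_bar p\<^esub> i\<in>{..Polynomial.degree U}. [Polynomial.coeff U i] \<cdot>\<^bsub>Fp_bar p\<^esub> (a [^]\<^bsub>Fp_bar p\<^esub> Suc i)) \<oplus>\<^bsub>Fp_bar p\<^esub> [c] \<cdot>\<^bsub>Fp_bar p\<^esub> \<one>\<^bsub>Fp_bar p\<^esub>"
    using a by (subst L.finsum_Suc2) (auto simp del: L.nat_pow_Suc simp: coeff_pCons)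
  also have "(\<Oplus>\<^bsub>Fp_bar p\<^esub> i\<in>{..Polynomial.degree U}. [Polynomial.coeff U i] \<cdot>\<^bsub>Fp_bar p\<^esub> (a [^]\<^bsub>Fp_bar p\<^esub> Suc i)) = a \<otimes>\<^bsub>Fp_bar p\<^esub> eval_Fp_bar p U a"
    unfolding eval_Fp_bar_def using a
    by (subst L.finsum_rdistr) (auto intro!: L.finsum_cong' simp: L.add_pow_rdistr_int L.m_comm)
  finally show ?thesis using a eval_Fp_bar_closed by (simp add: L.a_comm)
qed

lemma eval_Fp_bar_0: "eval_Fp_bar p 0 a = \<zero>\<^bsub>Fp_bar p\<^esub>" by (simp add: eval_Fp_bar_def int_add_pow_0)

lemma eval_Fp_bar_add: "eval_Fp_bar p (U + V) a = eval_Fp_bar p U a \<oplus>\<^bsub>Fp_bar p\<^esub> eval_Fp_bar p V a"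
proof (induction U V rule: poly_induct2)
  case (pCons b U c V)
  then show ?case using a eval_Fp_bar_closed[of U] eval_Fp_bar_closed[of V]
    by (simp add: eval_Fp_bar_pCons L.add.int_pow_mult L.r_distr L.a_ac)
qed (simp add: eval_Fp_bar_0)

lemma eval_Fp_bar_smult: "eval_Fp_bar p (Polynomial.smult c U) a = [c] \<cdot>\<^bsub>Fp_bar p\<^esub> eval_Fp_bar p U a"
proof (induction U)
  case (pCons b U)
  then show ?case using a eval_Fp_bar_closed[of U]
    by (simp add: eval_Fp_bar_pCons L.add_pow_rdistr_int L.add.int_pow_pow mult.commute L.add.int_pow_distrib)
qed (simp add: eval_Fp_bar_0)

lemma eval_Fp_bar_mult: "eval_Fp_bar p (U * V) a = eval_Fp_bar p U a \<otimes>\<^bsub>Fp_bar p\<^esub> eval_Fp_bar p V a"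
proof (induction U)
  case (pCons b U)
  let ?e = "\<lambda>U. eval_Fp_bar p U a"
  have "?e (pCons b U * V) = [b] \<cdot>\<^bsub>Fp_bar p\<^esub> ?e V \<oplus>\<^bsub>Fp_bar p\<^esub> a \<otimes>\<^bsub>Fp_bar p\<^esub> ?e (U * V)"
    using a eval_Fp_bar_closed[of "U * V"]
    by (simp add: eval_Fp_bar_pCons eval_Fp_bar_add eval_Fp_bar_smult int_add_pow_0)
  also have "\<dots> = ([b] \<cdot>\<^bsub>Fp_bar p\<^esub> \<one>\<^bsub>Fp_bar p\<^esub>) \<otimes>\<^bsub>Fp_bar p\<^esub> ?e V \<oplus>\<^bsub>Fp_bar p\<^esub> (a \<otimes>\<^bsub>Fp_bar p\<^esub> ?e U) \<otimes>\<^bsub>Fp_bar p\<^esub> ?e V"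
    using a eval_Fp_bar_closed[of U] eval_Fp_bar_closed[of V]
    by (simp add: pCons.IH L.add_pow_ldistr_int L.m_assoc)
  also have "\<dots> = ?e (pCons b U) \<otimes>\<^bsub>Fp_bar p\<^esub> ?e V"
    using a eval_Fp_bar_closed[of U] eval_Fp_bar_closed[of V]
    by (simp add: eval_Fp_bar_pCons L.l_distr)
  finally show ?case .
qed (simp add: eval_Fp_bar_0 eval_Fp_bar_closed)

lemma eval_Fp_bar_cong: assumes "[:int p:] dvd (U - V)" shows "eval_Fp_bar p U a = eval_Fp_bar p V a"
proof -
  obtain W where "U = V + [:int p:] * W" using assms by (metis dvdE add.commute diff_add_cancel)
  moreover have "eval_Fp_bar p [:int p:] a = \<zero>\<^bsub>Fp_bar p\<^esub>"
    using Fp_bar_field(2)[OF p] a by (simp add: eval_Fp_bar_pCons eval_Fp_bar_0)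
  ultimately show ?thesis using eval_Fp_bar_closed by (simp add: eval_Fp_bar_add eval_Fp_bar_mult del: mult_pCons_left)
qed

lemma has_value_unique:
  assumes "has_value p f a v" "has_value p f a w" shows "v = w"
proof -
  obtain U V A B where 1: "\<not> [:int p:] dvd B" "f = int_poly_to_ratfun A / int_poly_to_ratfun B"
    "[:int p:] dvd (U * B - A * V)" "eval_Fp_bar p V a \<noteq> \<zero>\<^bsub>Fp_bar p\<^esub>"
    "v = eval_Fp_bar p U a \<otimes>\<^bsub>Fp_bar p\<^esub> inv\<^bsub>Fp_bar p\<^esub> (eval_Fp_bar p V a)"
    using assms(1) unfolding has_value_def reduces_to_def by auto
  obtain U' V' A' B' where 2: "\<not> [:int p:] dvd B'" "f = int_poly_to_ratfun A' / int_poly_to_ratfun B'"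
    "[:int p:] dvd (U' * B' - A' * V')" "eval_Fp_bar p V' a \<noteq> \<zero>\<^bsub>Fp_bar p\<^esub>"
    "w = eval_Fp_bar p U' a \<otimes>\<^bsub>Fp_bar p\<^esub> inv\<^bsub>Fp_bar p\<^esub> (eval_Fp_bar p V' a)"
    using assms(2) unfolding has_value_def reduces_to_def by auto
  have nz: "int_poly_to_ratfun B \<noteq> 0" if "B \<noteq> 0" for B
    using that by (simp add: int_poly_to_ratfun_def map_poly_eq_0_iff)
  have "B \<noteq> 0" "B' \<noteq> 0" using 1 2 by auto
  then have "int_poly_to_ratfun A * int_poly_to_ratfun B' = int_poly_to_ratfun A' * int_poly_to_ratfun B"
    using 1(2) 2(2) nz by (auto simp: frac_eq_eq)
  then have "map_poly rat_of_int A * map_poly rat_of_int B' = map_poly rat_of_int A' * map_poly rat_of_int B"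
    unfolding int_poly_to_ratfun_def by (metis to_fract_mult to_fract_eq_iff)
  then have "map_poly rat_of_int (A * B') = map_poly rat_of_int (A' * B)"
    by (simp add: poly_eq_iff coeff_map_poly Polynomial.coeff_mult)
  then have AB: "A * B' = A' * B" by (simp add: poly_eq_iff coeff_map_poly)
  have "(U * V' - U' * V) * (B * B') = (U * B - A * V) * (V' * B') - (U' * B' - A' * V') * (V * B) + (A * B' - A' * B) * (V * V')"
    by (simp add: algebra_simps)
  then have "[:int p:] dvd (U * V' - U' * V) * (B * B')" using AB 1(3) 2(3)
    by (metis dvd_diff dvd_mult2 diff_self mult_zero_left add_0_right)
  moreover have "prime_elem [:int p:]" using p by (simp add: prime_elem_const_poly_iff)
  ultimately have "[:int p:] dvd (U * V' - U' * V)" using 1(1) 2(1) by (simp add: prime_elem_dvd_mult_iff)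
  then have cross: "eval_Fp_bar p U a \<otimes>\<^bsub>Fp_bar p\<^esub> eval_Fp_bar p V' a = eval_Fp_bar p U' a \<otimes>\<^bsub>Fp_bar p\<^esub> eval_Fp_bar p V a"
    using eval_Fp_bar_cong eval_Fp_bar_mult by metis
  have "eval_Fp_bar p V a \<in> Units (Fp_bar p)" "eval_Fp_bar p V' a \<in> Units (Fp_bar p)"
    using 1(4) 2(4) eval_Fp_bar_closed L.field_Units by auto
  then have inv: "inv\<^bsub>Fp_bar p\<^esub> eval_Fp_bar p V a \<in> carrier (Fp_bar p)"
      "inv\<^bsub>Fp_bar p\<^esub> eval_Fp_bar p V' a \<in> carrier (Fp_bar p)"
      "eval_Fp_bar p V a \<otimes>\<^bsub>Fp_bar p\<^esub> inv\<^bsub>Fp_bar p\<^esub> eval_Fp_bar p V a = \<one>\<^bsub>Fp_bar p\<^esub>"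
      "eval_Fp_bar p V' a \<otimes>\<^bsub>Fp_bar p\<^esub> inv\<^bsub>Fp_bar p\<^esub> eval_Fp_bar p V' a = \<one>\<^bsub>Fp_bar p\<^esub>"
    by simp_all
  have "u \<otimes>\<^bsub>Fp_bar p\<^esub> inv1 = u' \<otimes>\<^bsub>Fp_bar p\<^esub> inv2"
    if "u \<otimes>\<^bsub>Fp_bar p\<^esub> y' = u' \<otimes>\<^bsub>Fp_bar p\<^esub> y" "y \<otimes>\<^bsub>Fp_bar p\<^esub> inv1 = \<one>\<^bsub>Fp_bar p\<^esub>" "y' \<otimes>\<^bsub>Fp_bar p\<^esub> inv2 = \<one>\<^bsub>Fp_bar p\<^esub>"
      and carr: "u \<in> carrier (Fp_bar p)" "u' \<in> carrier (Fp_bar p)" "y \<in> carrier (Fp_bar p)"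
        "y' \<in> carrier (Fp_bar p)" "inv1 \<in> carrier (Fp_bar p)" "inv2 \<in> carrier (Fp_bar p)"
    for u u' y y' inv1 inv2
  proof -
    have "u \<otimes>\<^bsub>Fp_bar p\<^esub> inv1 = (u \<otimes>\<^bsub>Fp_bar p\<^esub> inv1) \<otimes>\<^bsub>Fp_bar p\<^esub> (y' \<otimes>\<^bsub>Fp_bar p\<^esub> inv2)"
      using that by simp
    also have "\<dots> = (u \<otimes>\<^bsub>Fp_bar p\<^esub> y') \<otimes>\<^bsub>Fp_bar p\<^esub> (inv1 \<otimes>\<^bsub>Fp_bar p\<^esub> inv2)"
      using carr by (simp add: L.m_ac)
    also have "\<dots> = (u' \<otimes>\<^bsub>Fp_bar p\<^esub> y) \<otimes>\<^bsub>Fp_bar p\<^esub> (inv1 \<otimes>\<^bsub>Fp_bar p\<^esub> inv2)"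
      by (simp only: that(1))
    also have "\<dots> = (u' \<otimes>\<^bsub>Fp_bar p\<^esub> inv2) \<otimes>\<^bsub>Fp_bar p\<^esub> (y \<otimes>\<^bsub>Fp_bar p\<^esub> inv1)"
      using carr by (simp add: L.m_ac)
    also have "\<dots> = u' \<otimes>\<^bsub>Fp_bar p\<^esub> inv2"
      using that by simp
    finally show ?thesis .
  qed
  from this[OF cross inv(3,4)] show ?thesis
    unfolding 1(5) 2(5) using eval_Fp_bar_closed inv(1,2) by blast
qed

end

definition ratfun_value :: "nat \<Rightarrow> ratfun \<Rightarrow> fp_elem \<Rightarrow> fp_elem" where
  "ratfun_value p f a = (THE v. has_value p f a v)"

definition neither_zero_nor_pole :: "nat \<Rightarrow> ratfun \<Rightarrow> fp_elem \<Rightarrow> bool" where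
  "neither_zero_nor_pole p f a \<longleftrightarrow> (\<exists>v. has_value p f a v \<and> v \<noteq> \<zero>\<^bsub>Fp_bar p\<^esub>)"

definition value_order :: "nat \<Rightarrow> ratfun \<Rightarrow> fp_elem \<Rightarrow> nat" where
  "value_order p f a = group.ord (mult_of (Fp_bar p)) (ratfun_value p f a)"

text \<open>The points where fewer than \<open>m - 1\<close> of the \<open>m\<close> values have order at least \<open>T\<close>.\<close>

definition exceptional_points :: "nat \<Rightarrow> ratfun list \<Rightarrow> real \<Rightarrow> fp_elem set" where
  "exceptional_points p fs T =
     {a \<in> carrier (Fp_bar p). (\<forall>f\<in>set fs. neither_zero_nor_pole p f a) \<and>
        card {i. i < length fs \<and> real (value_order p (fs ! i) a) \<ge> T} < length fs - 1}"

end

theory Submission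
  imports Defs "Subresultants.Subresultant_Gcd" "Berlekamp_Zassenhaus.Factor_Bound"
    "HOL-Real_Asymp.Real_Asymp"
begin

text \<open>
  If the conclusion fails at \<open>\<alpha>\<close>, two of the functions, \<open>f = P / Q\<close> and \<open>g = R / W\<close>, take values
  of small orders \<open>s\<close> and \<open>t\<close> there, so \<open>\<alpha>\<close> is a common zero modulo \<open>p\<close> of \<open>P\<^sup>s - Q\<^sup>s\<close> and
  \<open>R\<^sup>t - W\<^sup>t\<close>.  Outside the prime divisors of a resultant, which has \<open>O((s + t)\<^sup>2)\<close> binary digits,
  \<open>\<alpha>\<close> is then a zero modulo \<open>p\<close> of the greatest common divisor of these two polynomials in \<open>\<int>[X]\<close>.
  Its complex zeros are points where \<open>f\<close> and \<open>g\<close> are both roots of unity, and these are zeros of a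
  polynomial \<open>K\<close> that depends neither on \<open>s\<close> and \<open>t\<close> nor on \<open>p\<close>, and whose degree is bounded
  explicitly in terms of the degrees of \<open>f\<close> and \<open>g\<close>.

  To construct \<open>K\<close>, take a linear relation with rational coefficients between monomials in \<open>f\<close> and
  \<open>g\<close> that has the least possible number of terms.  At a torsion point it becomes a relation between
  roots of unity of some common order \<open>n\<close>.  If \<open>4\<close> divides \<open>n\<close>, conjugating a primitive \<open>n\<close>-th
  root of unity into its negative splits off a shorter relation, which cannot hold identically.
  Otherwise, as in the work of Beukers and Smyth, the relation also holds, up to signs, with all roots
  of unity replaced by their \<open>2\<^sup>i\<close>-th powers; by multiplicative independence not all of these
  relations can hold identically, since a real exponential sum has fewer zeros than terms.
\<close>

section \<open>Conjugates of roots of unity\<close>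

text \<open>The subresultant of index 0 is a determinant over \<open>int poly\<close> whose last row
  consists of products of \<open>f\<close> and \<open>g\<close> with powers of \<open>X\<close>, and
  its value is the resultant as a constant polynomial. Laplace expansion along that row exhibits
  \<open>u\<close> and \<open>v\<close>.\<close>

lemma resultant_eq_combination:
  fixes f g :: "int poly"
  assumes "Polynomial.degree f + Polynomial.degree g > 0"
  shows "\<exists>u v. u * f + v * g = [:resultant f g:]"
proof -
  let ?n = "Polynomial.degree f + Polynomial.degree g"
  let ?M = "subresultant_mat 0 f g"
  let ?e = "\<lambda>j. ?M $$ (?n - 1, j) * cofactor ?M (?n - 1) j"
  have M: "?M \<in> carrier_mat ?n ?n" by (rule carrier_matI) simp_all
  have "[:resultant f g:] = det ?M"
    by (metis subresultant_resultant subresultant_def)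
  also have "\<dots> = (\<Sum>j<?n. ?e j)"
    using laplace_expansion_row[OF M, of "?n - 1"] assms by simp
  also have "\<exists>u v. u * f + v * g = \<dots>"
  proof -
    have "\<exists>u v. u * f + v * g = ?e j" if j: "j < ?n" for j
    proof (cases "j < Polynomial.degree g")
      case True
      with j assms show ?thesis
        by (intro exI[of _ "monom 1 (Polynomial.degree g - 1 - j) * cofactor ?M (?n - 1) j"] exI[of _ 0])
           (simp add: subresultant_index_mat algebra_simps)
    next
      case False
      with j assms show ?thesis
        by (intro exI[of _ "monom 1 (Polynomial.degree f - 1 - (j - Polynomial.degree g)) * cofactor ?M (?n - 1) j"] exI[of _ 0])
           (auto simp add: subresultant_index_mat algebra_simps)
    qed
    then obtain u v where "\<And>j. j < ?n \<Longrightarrow> u j * f + v j * g = ?e j" by metis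
    then have "(\<Sum>j<?n. u j) * f + (\<Sum>j<?n. v j) * g = (\<Sum>j<?n. ?e j)"
      by (simp add: sum_distrib_right flip: sum.distrib)
    then show ?thesis by blast
  qed
  finally show ?thesis .
qed

text \<open>If \<open>f\<close> did not divide \<open>g\<close>, the two would be coprime with
  non-zero resultant; but the resultant is a combination of \<open>f\<close> and \<open>g\<close>
  and so vanishes at \<open>z\<close>. Prime elements of \<open>int poly\<close> thus serve as
  minimal polynomials.\<close>

lemma prime_elem_dvd_of_common_root:
  fixes f g :: "int poly" and z :: complex
  assumes "prime_elem f" "poly (of_int_poly f) z = 0" "poly (of_int_poly g) z = 0"
  shows "f dvd g"
proof (rule ccontr)
  assume n: "\<not> f dvd g"
  have f: "f \<noteq> 0" using assms(1) by auto
  have deg: "Polynomial.degree f > 0"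
  proof (rule ccontr)
    assume "\<not> ?thesis"
    then obtain c where "f = [:c:]" by (metis degree_eq_zeroE gr0I)
    with assms(2) f show False by simp
  qed
  have "coprime f g" proof (rule coprimeI)
    fix c assume "c dvd f" "c dvd g"
    then show "is_unit c" using n prime_elem_imp_irreducible[OF assms(1)]
      by (metis dvd_trans irreducible_altdef)
  qed
  then have "resultant f g \<noteq> 0" by (simp add: resultant_0_gcd)
  moreover obtain u v where "u * f + v * g = [:resultant f g:]"
    using resultant_eq_combination[of f g] deg by auto
  then have "poly (of_int_poly (u * f + v * g)) z = poly (of_int_poly [:resultant f g:]) z" by simp
  then have "of_int (resultant f g) = (0::complex)" using assms by (simp add: hom_distribs)
  ultimately show False by simp
qed

lemma fermat_int:
  fixes a :: int
  assumes "Factorial_Ring.prime (p::nat)"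
  shows "[a ^ p = a] (mod int p)"
proof -
  define b where "b = nat (a mod int p)"
  have p0: "p > 0" using assms prime_gt_0_nat by blast
  have ab: "[a = int b] (mod int p)" using p0 by (simp add: b_def cong_def)
  have "[b ^ p = b] (mod p)"
  proof (cases "p dvd b")
    case True
    then have "p dvd b ^ p" using p0 by (simp add: dvd_power_iff_le dvd_trans[OF _ dvd_power])
    with True show ?thesis by (metis cong_0_iff cong_sym cong_trans)
  next
    case False
    then have "[b ^ (p - 1) * b = 1 * b] (mod p)" using fermat_theorem[OF assms False] by (rule_tac cong_mult) auto
    moreover have "b ^ (p - 1) * b = b ^ p" using p0 by (rule power_minus_mult)
    ultimately show ?thesis by simp
  qed
  then have "[int b ^ p = int b] (mod int p)" using cong_int_iff[of "b ^ p" b p] by simp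
  with ab show ?thesis by (meson cong_pow cong_trans cong_sym)
qed

text \<open>Frobenius modulo \<open>p\<close>: the inner binomial coefficients are divisible by
  \<open>p\<close>, and constants are fixed by Fermat's little theorem.\<close>

lemma pow_prime_eq_pcompose_monom_mod:
  fixes h :: "int poly"
  assumes "Factorial_Ring.prime (p::nat)"
  shows "[:int p:] dvd (h ^ p - pcompose h (monom 1 p))"
proof (induction h)
  case 0
  have "p > 0" using assms prime_gt_0_nat by blast
  then show ?case by (simp add: power_0_left)
next
  case (pCons a h)
  have p0: "p > 0" using assms prime_gt_0_nat by blast
  let ?x = "monom 1 1 :: int poly"
  have e: "pCons a h = [:a:] + ?x * h" by (simp add: monom_altdef)
  have "(pCons a h) ^ p = (\<Sum>k\<le>p. of_nat (p choose k) * [:a:] ^ k * (?x * h) ^ (p - k))"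
    unfolding e by (rule binomial_ring)
  also have "{..p} = insert 0 (insert p {1..<p})" using p0 by auto
  also have "(\<Sum>k\<in>\<dots>. of_nat (p choose k) * [:a:] ^ k * (?x * h) ^ (p - k))
     = (?x * h) ^ p + [:a:] ^ p + (\<Sum>k\<in>{1..<p}. of_nat (p choose k) * [:a:] ^ k * (?x * h) ^ (p - k))"
    using p0 by (subst sum.insert) (auto simp: add.assoc)
  finally have 1: "(pCons a h) ^ p - ((?x * h) ^ p + [:a:] ^ p) =
     (\<Sum>k\<in>{1..<p}. of_nat (p choose k) * [:a:] ^ k * (?x * h) ^ (p - k))" by simp
  have "[:int p:] dvd of_nat (p choose k)" if "k \<in> {1..<p}" for k
  proof -
    have "p dvd (p choose k)" using that assms by (intro dvd_choose_prime) auto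
    then obtain c where "p choose k = p * c" by blast
    then have "of_nat (p choose k) = [:int p:] * (of_nat c :: int poly)"
      by (simp add: of_nat_poly)
    then show ?thesis by (metis dvd_triv_left)
  qed
  then have 2: "[:int p:] dvd (pCons a h) ^ p - ((?x * h) ^ p + [:a:] ^ p)"
    unfolding 1 by (intro dvd_sum) (simp add: mult.assoc)
  have "[a ^ p = a] (mod int p)"
    using assms by (rule fermat_int)
  then have 3: "[:int p:] dvd [:a:] ^ p - [:a:]"
    by (simp add: cong_iff_dvd_diff const_poly_dvd poly_const_pow)
  have 4: "[:int p:] dvd (?x * h) ^ p - monom 1 p * pcompose h (monom 1 p)"
  proof -
    have "(?x * h) ^ p - monom 1 p * pcompose h (monom 1 p) = monom 1 p * (h ^ p - pcompose h (monom 1 p))"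
      by (simp add: power_mult_distrib monom_power algebra_simps)
    then show ?thesis using pCons.IH by simp
  qed
  have "(pCons a h) ^ p - pcompose (pCons a h) (monom 1 p) =
     ((pCons a h) ^ p - ((?x * h) ^ p + [:a:] ^ p)) + ([:a:] ^ p - [:a:])
       + ((?x * h) ^ p - monom 1 p * pcompose h (monom 1 p))"
    by (simp add: pcompose_pCons)
  with 2 3 4 show ?case by (metis dvd_add)
qed


text \<open>Classical argument for the irreducibility of cyclotomic polynomials: let
  \<open>f\<close> be a prime factor of \<open>F\<close> vanishing at \<open>z\<close>, and
  \<open>X ^ n - 1 = f * h\<close>. If \<open>z ^ p\<close> were not a zero of \<open>f\<close>, it
  would be one of \<open>h\<close>, so \<open>f\<close> would divide \<open>h(X ^ p)\<close>, which
  is \<open>h ^ p\<close> modulo \<open>p\<close>; this contradicts the separability of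
  \<open>X ^ n - 1\<close> modulo \<open>p\<close>.\<close>

lemma root_of_unity_conj_prime:
  fixes F :: "int poly" and z :: complex
  assumes p: "Factorial_Ring.prime (p::nat)" and n: "n > 0" "\<not> p dvd n" and z: "z ^ n = 1"
    and F: "poly (of_int_poly F) z = 0"
  shows "poly (of_int_poly F) (z ^ p) = 0"
proof (cases "F = 0")
  case False
  have ex: "\<exists>f. prime_elem f \<and> f dvd G \<and> poly (of_int_poly f) z = 0"
    if "G \<noteq> 0" "poly (of_int_poly G) z = 0" for G :: "int poly"
    using that
  proof (induction G rule: prime_divisors_induct)
    case (unit G)
    then obtain H where "G * H = 1" by (metis dvdE)
    then have "poly (of_int_poly (G * H)) z = 1" by simp
    with unit show ?case by (simp add: hom_distribs)
  next
    case (factor q G)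
    show ?case
    proof (cases "poly (of_int_poly q) z = 0")
      case True
      then show ?thesis using factor.hyps by (intro exI[of _ q]) auto
    next
      case False
      then have "poly (of_int_poly G) z = 0" "G \<noteq> 0" using factor.prems by (auto simp: hom_distribs)
      then show ?thesis using factor.IH dvd_mult by blast
    qed
  qed auto
  obtain f where f: "prime_elem f" "f dvd F" "poly (of_int_poly f) z = 0"
    using ex[OF False F] by blast
  let ?X = "monom 1 n - 1 :: int poly"
  have "poly (of_int_poly ?X) z = 0" using z by (simp add: hom_distribs poly_monom)
  then have "f dvd ?X" using f by (intro prime_elem_dvd_of_common_root[of f z])
  then obtain h where h: "?X = f * h" by blast
  \<comment> \<open>\<open>X ^ n - 1\<close> is monic, so the leading coefficient of
    \<open>f\<close> is a unit and the degree of \<open>f\<close> survives reduction modulo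
    \<open>p\<close>.\<close>
  have lc: "lead_coeff f dvd 1"
  proof -
    have "lead_coeff ?X = 1" 
    proof -
      have "Polynomial.degree ?X = n"
        using n(1) by (simp only: diff_conv_add_uminus, subst degree_add_eq_left) (auto simp: degree_monom_eq)
      then show ?thesis using n(1) by simp
    qed
    then have "lead_coeff f * lead_coeff h = 1" using h by (simp add: lead_coeff_mult)
    then show ?thesis by (metis dvd_triv_left)
  qed
  have "poly (of_int_poly f) (z ^ p) = 0"
  proof (rule ccontr)
    assume nz: "poly (of_int_poly f) (z ^ p) \<noteq> 0"
    have "poly (of_int_poly ?X) (z ^ p) = 0" using z 
      by (simp add: hom_distribs poly_monom) (metis power_mult mult.commute power_one)
    then have "poly (of_int_poly h) (z ^ p) = 0" using nz by (simp add: h hom_distribs)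
    then have "poly (of_int_poly (pcompose h (monom 1 p))) z = 0"
      by (simp add: of_int_hom.map_poly_pcompose poly_pcompose poly_monom hom_distribs)
    then have "f dvd pcompose h (monom 1 p)" using f by (intro prime_elem_dvd_of_common_root[of f z])
    then obtain q where q: "pcompose h (monom 1 p) = f * q" by blast
    obtain r where r: "h ^ p = f * q + [:int p:] * r"
      using pow_prime_eq_pcompose_monom_mod[OF p, of h] q by (metis dvdE diff_add_cancel add.commute)
    \<comment> \<open>Modulo \<open>f\<close> and \<open>p\<close>, \<open>h\<close> is nilpotent while \<open>f' * h\<close> is the unit \<open>n * X ^ (n - 1)\<close>.\<close>
    have d: "of_nat n * monom 1 (n - 1) = pderiv f * h + f * pderiv h"
    proof -
      have "pderiv ?X = pderiv (f * h)" by (simp only: h)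
      moreover have "pderiv ?X = of_nat n * monom 1 (n - 1)"
        by (simp add: pderiv_diff pderiv_monom of_nat_poly smult_monom)
      ultimately show ?thesis by (simp add: pderiv_mult algebra_simps)
    qed
    \<comment> \<open>Multiplication by \<open>X\<close> turns the derivative into
      \<open>n * X ^ n = n * (1 + f * h)\<close>, so that \<open>w * h\<close> is congruent to the
      constant \<open>n\<close> modulo \<open>f\<close>.\<close>
    define w where "w = monom 1 1 * pderiv f"
    have "of_nat n * (1 + f * h) = w * h + f * (monom 1 1 * pderiv h)"
    proof -
      have "of_nat n * monom 1 n = monom 1 1 * (of_nat n * monom 1 (n - 1) :: int poly)"
        using n(1) by (simp add: mult_monom algebra_simps)
      also have "\<dots> = w * h + f * (monom 1 1 * pderiv h)" unfolding d w_def by (simp add: algebra_simps)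
      finally show ?thesis using h by (metis add.commute diff_add_cancel)
    qed
    then have "of_nat n = w * h + f * (monom 1 1 * pderiv h - of_nat n * h)"
      by (simp add: algebra_simps)
    then have "\<exists>s. of_nat n = w * h + f * s" by blast
    then obtain s where s: "(of_nat n :: int poly) = w * h + f * s" by blast
    have "f dvd (of_nat n :: int poly) ^ p - (w * h) ^ p"
      unfolding power_diff_sumr2 by (intro dvd_mult2) (simp add: s)
    then obtain s' where "(of_nat n :: int poly) ^ p - (w * h) ^ p = f * s'" by blast
    then have s': "(of_nat n :: int poly) ^ p = f * (w ^ p * q + s') + [:int p:] * (w ^ p * r)"
      using r by (simp add: power_mult_distrib algebra_simps)
    define u where "u = w ^ p * q + s'"
    have 1: "int p dvd Polynomial.coeff ([:int n:] ^ p - f * u) k" for k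
      using s' unfolding u_def[symmetric] by (simp add: of_nat_poly algebra_simps)
    \<comment> \<open>Modulo \<open>p\<close> the product \<open>f * u\<close> is the constant
      \<open>n ^ p\<close>. As \<open>f\<close> has positive degree and unit leading coefficient,
      the highest coefficient of \<open>u\<close> that is non-zero modulo \<open>p\<close> would
      survive in \<open>f * u\<close> in positive degree.\<close>
    have "int p dvd Polynomial.coeff u k" for k
    proof (rule ccontr)
      assume "\<not> int p dvd Polynomial.coeff u k"
      moreover have "finite {k. \<not> int p dvd Polynomial.coeff u k}"
        by (rule finite_subset[of _ "{..Polynomial.degree u}"]) (auto, metis coeff_eq_0 dvd_0_right not_le)
      ultimately obtain m where m: "\<not> int p dvd Polynomial.coeff u m" "\<And>j. j > m \<Longrightarrow> int p dvd Polynomial.coeff u j"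
        using Max_in[of "{k. \<not> int p dvd Polynomial.coeff u k}"] Max_ge[of "{k. \<not> int p dvd Polynomial.coeff u k}"]
        by (metis (mono_tags, lifting) empty_iff mem_Collect_eq not_le)
      let ?d = "Polynomial.degree f"
      have dpos: "?d > 0"
      proof (rule ccontr)
        assume "\<not> ?thesis"
        then obtain c where "f = [:c:]" by (metis degree_eq_zeroE gr0I)
        moreover have "f \<noteq> 0" using f(1) by auto
        ultimately show False using f(3) by simp
      qed
      have "Polynomial.coeff (f * u) (?d + m) = (\<Sum>i\<le>?d + m. Polynomial.coeff f i * Polynomial.coeff u (?d + m - i))"
        by (simp add: Polynomial.coeff_mult)
      also have "\<dots> = lead_coeff f * Polynomial.coeff u m + (\<Sum>i\<in>{..?d + m} - {?d}. Polynomial.coeff f i * Polynomial.coeff u (?d + m - i))"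
        by (subst sum.remove[of _ ?d]) auto
      finally have a: "Polynomial.coeff (f * u) (?d + m) = \<dots>" .
      have b: "int p dvd (\<Sum>i\<in>{..?d + m} - {?d}. Polynomial.coeff f i * Polynomial.coeff u (?d + m - i))"
      proof (intro dvd_sum)
        fix i assume i: "i \<in> {..?d + m} - {?d}"
        show "int p dvd Polynomial.coeff f i * Polynomial.coeff u (?d + m - i)"
        proof (cases "i < ?d")
          case True then show ?thesis using m(2)[of "?d + m - i"] by simp
        next
          case False then show ?thesis using i by (simp add: coeff_eq_0)
        qed
      qed
      have "int p dvd Polynomial.coeff (f * u) (?d + m)"
        using 1[of "?d + m"] dpos by (simp add: poly_const_pow coeff_pCons split: nat.splits)
      then have "int p dvd lead_coeff f * Polynomial.coeff u m" unfolding a using b by (simp add: dvd_add_left_iff)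
      then have "int p dvd Polynomial.coeff u m" using lc by (metis dvd_mult_unit_iff mult.commute)
      with m show False by simp
    qed
    then have "int p dvd Polynomial.coeff (f * u) 0" by (simp add: coeff_mult_0)
    then have "int p dvd int n ^ p" using 1[of 0] by (simp add: poly_const_pow dvd_diff_left_iff)
    then have "int p dvd int n" using p prime_dvd_power by (metis prime_nat_int_transfer)
    with n show False by simp
  qed
  then show ?thesis using f(2) by (auto elim!: dvdE simp: hom_distribs)
qed auto

text \<open>Induction over the prime factors of \<open>k\<close>, none of which divides
  \<open>n\<close>; each of them moves the zero from \<open>z\<close> to
  \<open>z ^ p\<close>.\<close>

lemma root_of_unity_conj:
  fixes F :: "int poly" and z :: complex
  assumes n: "n > 0" and z: "z ^ n = 1" and F: "poly (of_int_poly F) z = 0" and k: "gcd k n = 1"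
  shows "poly (of_int_poly F) (z ^ k) = 0"
  using z F k
proof (induction k arbitrary: z rule: prime_divisors_induct)
  case zero
  then show ?case by simp
next
  case (factor p k)
  have "\<not> p dvd n"
    using factor.hyps factor.prems(3) by (metis dvd_triv_left gcd_greatest not_prime_unit)
  moreover have "gcd k n = 1"
    using factor.prems(3) by (metis dvd_mult dvd_refl gcd_mono nat_dvd_1_iff_1)
  ultimately have k: "\<not> p dvd n" "gcd k n = 1" by simp_all
  then have "poly (of_int_poly F) (z ^ p) = 0"
    using factor n k by (intro root_of_unity_conj_prime[of p n]) auto
  moreover have "(z ^ p) ^ n = 1" using factor by (metis power_mult mult.commute power_one)
  ultimately show ?case using factor.IH[of "z ^ p"] k by (simp add: power_mult)
qed auto

section \<open>Torsion points on a parametrised curve\<close>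

text \<open>Rolle's theorem applied to the sum divided by one of its terms.\<close>
lemma exp_sum_zeros:
  fixes l c :: "'v \<Rightarrow> real" and Z :: "real set"
  assumes "finite V" "inj_on l V" "finite Z" "card Z \<ge> card V" "V \<noteq> {}"
    and "\<And>t. t \<in> Z \<Longrightarrow> (\<Sum>v\<in>V. c v * exp (l v * t)) = 0"
  shows "\<forall>v\<in>V. c v = 0"
  using assms
proof (induction "card V" arbitrary: V l c Z)
  case 0
  then show ?case by auto
next
  case (Suc n)
  obtain v0 where v0: "v0 \<in> V" using Suc.prems by blast
  let ?W = "V - {v0}"
  have fW: "finite ?W" and cW: "card ?W = n" using Suc v0 by auto
  have eq: "c v0 + (\<Sum>v\<in>?W. c v * exp ((l v - l v0) * t)) = (\<Sum>v\<in>V. c v * exp (l v * t)) * exp (- l v0 * t)" for t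
  proof -
    have "(\<Sum>v\<in>V. c v * exp (l v * t)) * exp (- l v0 * t) = (\<Sum>v\<in>V. c v * exp ((l v - l v0) * t))"
      unfolding sum_distrib_right by (intro sum.cong) (auto simp: mult.assoc algebra_simps simp flip: exp_add)
    also have "\<dots> = c v0 + (\<Sum>v\<in>?W. c v * exp ((l v - l v0) * t))"
      using Suc.prems(1) v0 by (subst sum.remove[of _ v0]) auto
    finally show ?thesis ..
  qed
  have W0: "\<forall>v\<in>?W. c v = 0"
  proof (cases "?W = {}")
    case False
    \<comment> \<open>Normalised so that the term at \<open>v0\<close> is constant, the sum loses
      that term on differentiation. Rolle also costs just one zero, so the induction closes.\<close>
    define h where "h t = c v0 + (\<Sum>v\<in>?W. c v * exp ((l v - l v0) * t))" for t
    define h' where "h' t = (\<Sum>v\<in>?W. (c v * (l v - l v0)) * exp ((l v - l v0) * t))" for t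
    have der: "(h has_real_derivative h' t) (at t)" for t
      unfolding h_def h'_def by (auto intro!: derivative_eq_intros sum.cong)
    have hz: "h t = 0" if "t \<in> Z" for t
      using Suc.prems(6)[OF that] eq[of t] by (simp add: h_def)
    obtain xs where xs: "sorted_wrt (<) xs" "set xs = Z" "length xs = card Z"
      using Suc.prems(3) by (metis strict_sorted_list_of_set set_sorted_list_of_set length_sorted_list_of_set)
    have "\<exists>y. xs ! i < y \<and> y < xs ! Suc i \<and> h' y = 0" if "i < n" for i
    proof -
      have i: "Suc i < length xs" using that xs Suc by auto
      have lt: "xs ! i < xs ! Suc i" using xs(1) i by (simp add: sorted_wrt_nth_less)
      have "h (xs ! i) = h (xs ! Suc i)" using i xs(2) hz by (metis Suc_lessD nth_mem)
      moreover have "continuous_on {xs ! i..xs ! Suc i} h"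
        using der by (meson DERIV_isCont continuous_at_imp_continuous_on)
      ultimately show ?thesis
        using Rolle_deriv[OF lt, of h "\<lambda>t x. h' t * x"] der
        by (metis has_field_derivative_def has_derivative_imp_has_field_derivative mult_1_right)
    qed
    then obtain y where y: "\<And>i. i < n \<Longrightarrow> xs ! i < y i \<and> y i < xs ! Suc i \<and> h' (y i) = 0" by metis
    have mono: "y i < y j" if "i < j" "j < n" for i j
    proof -
      have "xs ! Suc i \<le> xs ! j"
      proof (cases "Suc i = j")
        case False
        then show ?thesis using that xs Suc by (intro less_imp_le sorted_wrt_nth_less[OF xs(1)]) auto
      qed auto
      then show ?thesis using y[of i] y[of j] that by auto
    qed
    have "inj_on y {..<n}"
      by (rule linorder_inj_onI) (use mono in \<open>auto simp: less_imp_neq\<close>)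
    then have cy: "card (y ` {..<n}) = n" by (simp add: card_image)
    have "\<forall>v\<in>?W. c v * (l v - l v0) = 0"
    proof (rule Suc.hyps(1)[of ?W "\<lambda>v. l v - l v0" "y ` {..<n}"])
      show "inj_on (\<lambda>v. l v - l v0) ?W" using Suc.prems(2) by (auto simp: inj_on_def)
      show "(\<Sum>v\<in>?W. c v * (l v - l v0) * exp ((l v - l v0) * t)) = 0" if "t \<in> y ` {..<n}" for t
        using y that unfolding h'_def by auto
    qed (use False fW cW cy in auto)
    moreover have "l v \<noteq> l v0" if "v \<in> ?W" for v using that v0 Suc.prems(2) by (auto dest: inj_onD)
    ultimately show ?thesis by auto
  qed auto
  moreover have "c v0 = 0"
  proof -
    have "Z \<noteq> {}" using Suc by auto
    then obtain t where "t \<in> Z" by blast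
    then have "c v0 + (\<Sum>v\<in>?W. c v * exp ((l v - l v0) * t)) = 0" using eq[of t] Suc.prems(6) by simp
    then show ?thesis using W0 by simp
  qed
  ultimately show ?case by blast
qed

text \<open>With \<open>y v = exp (ln (y v))\<close> this is an exponential sum in \<open>t\<close>
  that vanishes at the distinct points \<open>t = 2 ^ i\<close>, of which there are at least as many
  as terms.\<close>

lemma power_sum_eq_0_imp_coeffs_eq_0:
  fixes y c :: "'v \<Rightarrow> real" and L :: nat
  assumes V: "finite V" "card V \<le> L" and pos: "\<And>v. v \<in> V \<Longrightarrow> y v > 0" and inj: "inj_on y V"
    and z: "\<And>i. i \<in> {1..L} \<Longrightarrow> (\<Sum>v\<in>V. c v * y v ^ (2 ^ i)) = 0"
  shows "\<forall>v\<in>V. c v = 0"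
proof (cases "V = {}")
  case False
  let ?Z = "(\<lambda>i::nat. (2::real) ^ i) ` {1..L}"
  have "inj_on (\<lambda>i::nat. (2::real) ^ i) {1..L}" by (auto simp: inj_on_def)
  then have "card ?Z = L" by (simp add: card_image)
  have "\<forall>v\<in>V. c v = 0"
  proof (rule exp_sum_zeros[of V "\<lambda>v. ln (y v)" ?Z])
    show "inj_on (\<lambda>v. ln (y v)) V" using pos inj by (auto simp: inj_on_def)
    show "(\<Sum>v\<in>V. c v * exp (ln (y v) * t)) = 0" if "t \<in> ?Z" for t
    proof -
      obtain i where i: "i \<in> {1..L}" "t = 2 ^ i" using \<open>t \<in> ?Z\<close> by blast
      have "exp (ln (y v) * t) = y v ^ (2 ^ i)" if "v \<in> V" for v
      proof -
        have "exp (ln (y v) * t) = y v powr real (2 ^ i)" using pos[OF that] i by (simp add: powr_def mult.commute)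
        also have "\<dots> = y v ^ (2 ^ i)" using pos[OF that] by (rule powr_realpow)
        finally show ?thesis .
      qed
      then show ?thesis using z[OF i(1)] by simp
    qed
  qed (use V False \<open>card ?Z = L\<close> in auto)
  then show ?thesis .
qed auto

text \<open>Gaussian elimination on the coefficients of \<open>X ^ D\<close>.\<close>
lemma poly_linear_dependence:
  fixes N :: "'v \<Rightarrow> int poly"
  assumes "finite V" "card V > D" "\<And>v k. v \<in> V \<Longrightarrow> k \<ge> D \<Longrightarrow> Polynomial.coeff (N v) k = 0"
  shows "\<exists>c. (\<exists>v\<in>V. c v \<noteq> 0) \<and> (\<Sum>v\<in>V. Polynomial.smult (c v) (N v)) = 0"
  using assms
proof (induction D arbitrary: V N)
  case 0
  then have "N v = 0" if "v \<in> V" for v using that by (simp add: poly_eq_iff)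
  moreover have "\<exists>v. v \<in> V" using 0 by (metis card.empty less_irrefl equals0I)
  ultimately show ?case by (intro exI[of _ "\<lambda>_. 1"]) auto
next
  case (Suc D)
  show ?case
  proof (cases "\<forall>v\<in>V. Polynomial.coeff (N v) D = 0")
    case True
    then show ?thesis using Suc by (intro Suc.IH) (auto, metis le_antisym not_less_eq_eq)
  next
    case False
    then obtain w where w: "w \<in> V" "Polynomial.coeff (N w) D \<noteq> 0" by blast
    let ?a = "\<lambda>v. Polynomial.coeff (N v) D"
    define N' where "N' v = Polynomial.smult (?a w) (N v) - Polynomial.smult (?a v) (N w)" for v
    have "\<exists>c. (\<exists>v\<in>V-{w}. c v \<noteq> 0) \<and> (\<Sum>v\<in>V-{w}. Polynomial.smult (c v) (N' v)) = 0"
    proof (rule Suc.IH)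
      show "Polynomial.coeff (N' v) k = 0" if "v \<in> V - {w}" "D \<le> k" for v k
        using that Suc.prems(3)[of v k] Suc.prems(3)[of w k] w(1)
        by (cases "k = D") (auto simp: N'_def)
    qed (use Suc.prems w in auto)
    then obtain c v1 where c: "v1 \<in> V - {w}" "c v1 \<noteq> 0" "(\<Sum>v\<in>V-{w}. Polynomial.smult (c v) (N' v)) = 0" by blast
    \<comment> \<open>Elimination cross-multiplies by the pivot coefficient instead of dividing by
      it. So the \<open>c v\<close> are scaled by \<open>?a w\<close>, the coefficient of the pivot
      \<open>w\<close> balances the contributions of the others, and all remain integers.\<close>
    define c' where "c' v = (if v = w then - (\<Sum>u\<in>V-{w}. c u * ?a u) else c v * ?a w)" for v
    have "(\<Sum>v\<in>V. Polynomial.smult (c' v) (N v)) =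
        Polynomial.smult (c' w) (N w) + (\<Sum>v\<in>V-{w}. Polynomial.smult (c' v) (N v))"
      using Suc.prems(1) w(1) by (rule sum.remove)
    also have "(\<Sum>v\<in>V-{w}. Polynomial.smult (c' v) (N v)) =
        (\<Sum>v\<in>V-{w}. Polynomial.smult (c v) (N' v) + Polynomial.smult (c v * ?a v) (N w))"
      by (intro sum.cong) (auto simp: c'_def N'_def smult_diff_right)
    also have "\<dots> = Polynomial.smult (\<Sum>v\<in>V-{w}. c v * ?a v) (N w)"
      using c(3) by (simp add: sum.distrib smult_sum)
    also have "Polynomial.smult (c' w) (N w) + \<dots> = 0" by (simp add: c'_def)
    finally have "(\<Sum>v\<in>V. Polynomial.smult (c' v) (N v)) = 0" .
    moreover have "v1 \<in> V" "c' v1 \<noteq> 0" using c w by (auto simp: c'_def)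
    ultimately show ?thesis by blast
  qed
qed

text \<open>Write all \<open>t v\<close> as powers \<open>z ^ a v\<close> of a primitive root of
  unity of their least common order \<open>n\<close>; the relation persists when \<open>z\<close> is
  replaced by \<open>z ^ k\<close> with \<open>k\<close> prime to \<open>n\<close>. Used are
  \<open>k = 1 + n / 2\<close> if 4 divides \<open>n\<close>, \<open>k = 2 ^ i + n / 2\<close> if
  \<open>n\<close> is twice an odd number, and \<open>k = 2 ^ i\<close> if \<open>n\<close> is
  odd.\<close>

lemma roots_of_unity_relation:
  fixes c :: "'v \<Rightarrow> int" and t :: "'v \<Rightarrow> complex"
  assumes V: "finite V" "v0 \<in> V" "t v0 = 1" and unity: "\<And>v. v \<in> V \<Longrightarrow> \<exists>n>0. t v ^ n = 1"
    and rel: "(\<Sum>v\<in>V. of_int (c v) * t v) = 0"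
  shows "(\<exists>U. U \<subset> V \<and> v0 \<in> U \<and> (\<Sum>v\<in>U. of_int (c v) * t v) = 0) \<or>
    (\<exists>d. (\<forall>v\<in>V. d v \<in> {1, -1}) \<and> (\<forall>i\<ge>1. (\<Sum>v\<in>V. of_int (c v * d v) * t v ^ (2 ^ i)) = 0))"
proof -
  define P where "P n \<longleftrightarrow> n > 0 \<and> (\<forall>v\<in>V. t v ^ n = 1)" for n :: nat
  obtain e where e: "\<And>v. v \<in> V \<Longrightarrow> e v > 0 \<and> t v ^ e v = 1" using unity by metis
  have "P (\<Prod>v\<in>V. e v)"
    unfolding P_def
  proof (intro conjI ballI)
    show "(\<Prod>v\<in>V. e v) > 0" using e by (simp add: prod_pos)
    show "t v ^ (\<Prod>v\<in>V. e v) = 1" if "v \<in> V" for v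
      using e[OF that] V(1) that by (subst prod.remove[of _ v]) (auto simp: power_mult)
  qed
  then obtain n where n: "P n" and min: "\<And>m. P m \<Longrightarrow> n \<le> m"
    using LeastI[of P] Least_le[of P] by blast
  have n0: "n > 0" and tn: "\<And>v. v \<in> V \<Longrightarrow> t v ^ n = 1" using n by (auto simp: P_def)
  define z where "z = cis (2 * pi / real n)"
  have zpow: "z ^ k = cis (2 * pi * real k / real n)" for k by (simp add: z_def DeMoivre field_simps)
  have zn: "z ^ n = 1" using n0 by (simp add: zpow)
  have "\<exists>a. t v = z ^ a" if "v \<in> V" for v
    using bij_betw_roots_unity[OF n0] tn[OF that] unfolding zpow bij_betw_def by blast
  then obtain a where a: "\<And>v. v \<in> V \<Longrightarrow> t v = z ^ a v" by metis
  define F where "F = (\<Sum>v\<in>V. monom (c v) (a v))"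
  have pF: "poly (of_int_poly F) x = (\<Sum>v\<in>V. of_int (c v) * x ^ a v)" for x :: complex
    by (simp add: F_def hom_distribs poly_sum poly_monom)
  have F0: "poly (of_int_poly F) z = 0" using rel a by (simp add: pF)
  have half: "z ^ (n div 2) = -1" if "even n"
  proof -
    have "2 * pi * real (n div 2) / real n = pi" using that n0 by (auto elim!: evenE)
    then show ?thesis by (simp only: zpow cis_pi)
  qed
  have conj: "(\<Sum>v\<in>V. of_int (c v) * (z ^ k) ^ a v) = 0" if "gcd k n = 1" for k
    using root_of_unity_conj[OF n0 zn F0 that] by (simp add: pF)
  show ?thesis
  proof (cases "4 dvd n")
    case True
    then have ev: "even n" by presburger
    \<comment> \<open>As \<open>z ^ (1 + n div 2) = - z\<close>, adding the conjugate relation to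
      the original one doubles the terms with even exponent and cancels the others.\<close>
    let ?U = "{v\<in>V. even (a v)}"
    have "gcd (1 + n div 2) n = 1"
    proof -
      obtain m where m: "n = 4 * m" using True by blast
      have "gcd (Suc (2 * m)) (2 * m) = 1" "gcd (Suc (2 * m)) 2 = 1"
        using coprime_Suc_left_nat[of "2 * m"] by (simp_all only: coprime_iff_gcd_eq_1) (simp flip: coprime_iff_gcd_eq_1)
      then have "gcd (Suc (2 * m)) (2 * (2 * m)) = 1"
        by (simp only: coprime_mult_right_iff flip: coprime_iff_gcd_eq_1)
      then show ?thesis by (simp add: m)
    qed
    from conj[OF this] have "(\<Sum>v\<in>V. of_int (c v) * (z ^ (1 + n div 2)) ^ a v) = 0" .
    also have "(\<Sum>v\<in>V. of_int (c v) * (z ^ (1 + n div 2)) ^ a v) = (\<Sum>v\<in>V. of_int (c v) * (t v * (-1) ^ a v))"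
      by (intro sum.cong refl) (simp only: a power_add power_mult_distrib half[OF ev] power_one_right)
    finally have "(\<Sum>v\<in>V. of_int (c v) * (t v * (-1) ^ a v)) = 0" .
    with rel have "0 = (\<Sum>v\<in>V. of_int (c v) * (t v * (-1) ^ a v) + of_int (c v) * t v)"
      by (simp add: sum.distrib)
    also have "\<dots> = (\<Sum>v\<in>V. if even (a v) then 2 * (of_int (c v) * t v) else 0)"
      by (intro sum.cong) auto
    also have "\<dots> = 2 * (\<Sum>v\<in>?U. of_int (c v) * t v)"
      using V(1) by (simp add: sum.If_cases sum_distrib_left Int_def)
    finally have "(\<Sum>v\<in>?U. of_int (c v) * t v) = 0" by simp
    moreover have "v0 \<in> ?U"
    proof -
      have "(-1::complex) ^ a v0 = (z ^ a v0) ^ (n div 2)"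
        by (metis half[OF ev] power_mult mult.commute)
      then have "(-1::complex) ^ a v0 = 1" using a[OF V(2)] V(3) by simp
      then show ?thesis using V(2) by (metis (mono_tags, lifting) mem_Collect_eq neg_one_odd_power one_neq_neg_one)
    qed
    \<comment> \<open>Here the minimality of \<open>n\<close> enters: if all exponents were even,
      \<open>n div 2\<close> would also be a common order.\<close>
    moreover have "?U \<noteq> V"
    proof
      assume U: "?U = V"
      have "P (n div 2)" unfolding P_def
      proof (intro conjI ballI)
        show "n div 2 > 0" using n0 ev by auto
        fix v assume v: "v \<in> V"
        then have "t v ^ (n div 2) = (z ^ (n div 2)) ^ a v" using a by (metis power_mult mult.commute)
        moreover have "even (a v)" using U v by blast
        ultimately show "t v ^ (n div 2) = 1" by (simp add: half[OF ev])
      qed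
      from min[OF this] n0 show False by auto
    qed
    ultimately show ?thesis by (intro disjI1 exI[of _ ?U]) auto
  next
    case False
    \<comment> \<open>For \<open>n = 2 * m\<close> with odd \<open>m\<close>, the power
      \<open>z ^ (2 ^ i + m)\<close> is the negative of \<open>z ^ (2 ^ i)\<close>. The resulting
      signs do not depend on \<open>i\<close>, so the same coefficients \<open>c v * d v\<close>
      serve all \<open>i\<close> at once.\<close>
    define d where "d v = (if even n then (-1) ^ a v else 1 :: int)" for v
    have "(\<Sum>v\<in>V. of_int (c v * d v) * t v ^ (2 ^ i)) = 0" if i: "i \<ge> 1" for i
    proof (cases "even n")
      case True
      then obtain m where m: "n = 2 * m" by blast
      have om: "odd m" using False m by auto
      have "gcd (2 ^ i + m) m = 1" using om by (simp add: flip: coprime_iff_gcd_eq_1)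
      moreover have "gcd (2 ^ i + m) 2 = 1" using i om by (simp flip: coprime_iff_gcd_eq_1)
      ultimately have "gcd (2 ^ i + m) (2 * m) = 1"
        by (simp only: coprime_mult_right_iff flip: coprime_iff_gcd_eq_1)
      then have "gcd (2 ^ i + m) n = 1" by (simp only: m)
      from conj[OF this] have "(\<Sum>v\<in>V. of_int (c v) * (z ^ (2 ^ i + m)) ^ a v) = 0" .
      also have "(\<Sum>v\<in>V. of_int (c v) * (z ^ (2 ^ i + m)) ^ a v) = (\<Sum>v\<in>V. of_int (c v * d v) * t v ^ (2 ^ i))"
      proof (intro sum.cong refl)
        fix v assume v: "v \<in> V"
        have "z ^ m = -1" using half[OF True] m by simp
        then have "(z ^ (2 ^ i + m)) ^ a v = (z ^ 2 ^ i) ^ a v * (-1) ^ a v" by (simp only: power_add power_mult_distrib)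
        also have "(z ^ 2 ^ i) ^ a v = t v ^ 2 ^ i" using a[OF v] by (metis power_mult mult.commute)
        finally show "of_int (c v) * (z ^ (2 ^ i + m)) ^ a v = of_int (c v * d v) * t v ^ 2 ^ i"
          using True by (simp add: d_def)
      qed
      finally show ?thesis .
    next
      case odd: False
      then have "gcd (2 ^ i) n = 1" by (simp flip: coprime_iff_gcd_eq_1)
      from conj[OF this] have "(\<Sum>v\<in>V. of_int (c v) * (z ^ (2 ^ i)) ^ a v) = 0" .
      also have "(\<Sum>v\<in>V. of_int (c v) * (z ^ (2 ^ i)) ^ a v) = (\<Sum>v\<in>V. of_int (c v * d v) * t v ^ (2 ^ i))"
        using a odd by (intro sum.cong refl) (auto simp: d_def simp flip: power_mult, metis mult.commute)
      finally show ?thesis .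
    qed
    moreover have "\<forall>v\<in>V. d v \<in> {1, -1}" by (simp add: d_def minus_one_power_iff)
    ultimately show ?thesis by blast
  qed
qed

lemma ex_int_nonroot:
  fixes p :: "int poly"
  assumes "p \<noteq> 0"
  shows "\<exists>x. poly p x \<noteq> 0"
  using assms poly_all_0_iff_0 by blast

text \<open>Take a relation \<open>c\<close> with smallest support. \<open>K\<close> is the product
  of its proper subsums \<open>G U\<close> through \<open>v0\<close> and, for each set
  \<open>W\<close> of sign changes, of one non-zero \<open>H W i\<close>, the signed relation
  between \<open>2 ^ i\<close>-th powers. At a torsion point \<open>roots_of_unity_relation\<close>
  makes one of these factors vanish.\<close>

lemma torsion_cover:
  fixes N :: "'v \<Rightarrow> int poly"
  assumes V: "finite V" "card V > Suc D" and deg: "\<And>v. v \<in> V \<Longrightarrow> Polynomial.degree (N v) \<le> D"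
    and nz: "\<And>v. v \<in> V \<Longrightarrow> N v \<noteq> 0"
    and sep: "\<And>v w. v \<in> V \<Longrightarrow> w \<in> V \<Longrightarrow> v \<noteq> w \<Longrightarrow> N v ^ 2 \<noteq> N w ^ 2"
  shows "\<exists>K. K \<noteq> 0 \<and> Polynomial.degree K \<le> 2 * 4 ^ card V * D \<and>
    (\<forall>x::complex. (\<forall>v\<in>V. poly (of_int_poly (N v)) x \<noteq> 0) \<longrightarrow>
      (\<forall>v\<in>V. \<forall>w\<in>V. \<exists>n>0. poly (of_int_poly (N v)) x ^ n = poly (of_int_poly (N w)) x ^ n) \<longrightarrow>
      poly (of_int_poly K) x = 0)"
proof -
  define R where "R c \<longleftrightarrow> (\<exists>v\<in>V. c v \<noteq> 0) \<and> (\<Sum>v\<in>V. Polynomial.smult (c v) (N v)) = 0" for c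
  define S where "S c = {v\<in>V. c v \<noteq> 0}" for c :: "'v \<Rightarrow> int"
  have exR: "\<exists>c. R c" unfolding R_def
  proof (rule poly_linear_dependence[of _ "Suc D"])
    show "Polynomial.coeff (N v) k = 0" if "v \<in> V" "k \<ge> Suc D" for v k
      using deg[OF that(1)] that(2) by (intro coeff_eq_0) simp
  qed (use V in auto)
  obtain c where c: "R c" and min: "\<And>c'. R c' \<Longrightarrow> card (S c) \<le> card (S c')"
    using ex_has_least_nat[of R _ "\<lambda>c. card (S c)"] exR by metis
  let ?S = "S c"
  have fS: "finite ?S" and SV: "?S \<subseteq> V" and cSV: "card ?S \<le> card V" using V(1) by (auto simp: S_def intro: card_mono)
  obtain v0 where v0: "v0 \<in> ?S" using c by (auto simp: R_def S_def)
  have relS: "(\<Sum>v\<in>?S. Polynomial.smult (c v) (N v)) = 0"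
  proof -
    have "(\<Sum>v\<in>V. Polynomial.smult (c v) (N v)) = (\<Sum>v\<in>?S. Polynomial.smult (c v) (N v))"
      using V(1) by (intro sum.mono_neutral_right) (auto simp: S_def)
    then show ?thesis using c by (simp add: R_def)
  qed
  define G where "G U = (\<Sum>v\<in>U. Polynomial.smult (c v) (N v))" for U
  define sg where "sg W v = (if v \<in> W then -1 else 1 :: int)" for W and v :: 'v
  define H where "H W i = (\<Sum>v\<in>?S. Polynomial.smult (c v * sg W v) (N v ^ (2 ^ i)))" for W i
  let ?Us = "{U. U \<subset> ?S \<and> v0 \<in> U}"
  \<comment> \<open>A vanishing subsum would be a relation with smaller support, non-trivial because
    it contains \<open>v0\<close>.\<close>
  have G0: "G U \<noteq> 0" if U: "U \<in> ?Us" for U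
  proof
    assume g: "G U = 0"
    let ?c = "\<lambda>v. if v \<in> U then c v else 0"
    have UV: "U \<subseteq> V" using U SV by auto
    have "(\<Sum>v\<in>V. Polynomial.smult (?c v) (N v)) = (\<Sum>v\<in>U. Polynomial.smult (?c v) (N v))"
      using V(1) UV by (intro sum.mono_neutral_right) auto
    also have "\<dots> = G U" unfolding G_def by (intro sum.cong) auto
    finally have "R ?c" using g U UV v0 by (auto simp: R_def S_def)
    then have 1: "card ?S \<le> card (S ?c)" by (rule min)
    have fU: "finite U" using fS U by (auto intro: finite_subset)
    have "card (S ?c) \<le> card U" using fU by (intro card_mono) (auto simp: S_def)
    moreover have "card U < card ?S" using fS U by (intro psubset_card_mono) auto
    ultimately show False using 1 by simp
  qed
  have exi: "\<exists>i\<in>{1..card V}. H W i \<noteq> 0" for W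
  proof (rule ccontr)
    assume "\<not> ?thesis"
    then have H0: "\<And>i. i \<in> {1..card V} \<Longrightarrow> H W i = 0" by blast
    \<comment> \<open>Where \<open>p\<close> does not vanish, the integers
      \<open>poly (N v) x\<close> are non-zero with distinct absolute values. As
      \<open>i \<ge> 1\<close> makes \<open>2 ^ i\<close> even, they may be replaced by their
      absolute values, which turns the relations into power sums with distinct positive
      bases.\<close>
    define p where "p = (\<Prod>v\<in>V. N v) * (\<Prod>(v, w)\<in>{(v, w). v \<in> V \<and> w \<in> V \<and> v \<noteq> w}. N v ^ 2 - N w ^ 2)"
    have fin: "finite {(v, w). v \<in> V \<and> w \<in> V \<and> v \<noteq> w}"
      by (rule finite_subset[of _ "V \<times> V"]) (use V(1) in auto)
    have "p \<noteq> 0" using nz sep V(1) fin by (auto simp: p_def)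
    then obtain x where x: "poly p x \<noteq> 0" using ex_int_nonroot by blast
    have x1: "poly (N v) x \<noteq> 0" if "v \<in> V" for v
      using x that V(1) by (auto simp: p_def poly_prod)
    have x2: "poly (N v) x ^ 2 \<noteq> poly (N w) x ^ 2" if "v \<in> V" "w \<in> V" "v \<noteq> w" for v w
    proof -
      have "(\<Prod>(v, w)\<in>{(v, w). v \<in> V \<and> w \<in> V \<and> v \<noteq> w}. poly (N v ^ 2 - N w ^ 2) x) \<noteq> 0"
        using x by (auto simp: p_def poly_prod case_prod_unfold)
      moreover have "poly (N v ^ 2 - N w ^ 2) x = 0 \<Longrightarrow>
          (\<Prod>(v, w)\<in>{(v, w). v \<in> V \<and> w \<in> V \<and> v \<noteq> w}. poly (N v ^ 2 - N w ^ 2) x) = 0"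
        using that by (intro prod_zero[OF fin] bexI[of _ "(v, w)"]) auto
      ultimately show ?thesis by auto
    qed
    define y where "y v = \<bar>real_of_int (poly (N v) x)\<bar>" for v
    have "\<forall>v\<in>?S. real_of_int (c v * sg W v) = 0"
    proof (rule power_sum_eq_0_imp_coeffs_eq_0[of _ "card V" y])
      show "inj_on y ?S"
      proof (rule inj_onI)
        fix v w assume vw: "v \<in> ?S" "w \<in> ?S" "y v = y w"
        then have "\<bar>poly (N v) x\<bar> = \<bar>poly (N w) x\<bar>" by (simp add: y_def)
        then have "poly (N v) x ^ 2 = poly (N w) x ^ 2" by (simp add: power2_eq_iff abs_eq_iff)
        then show "v = w" using x2 vw SV by blast
      qed
      show "(\<Sum>v\<in>?S. real_of_int (c v * sg W v) * y v ^ 2 ^ i) = 0" if i: "i \<in> {1..card V}" for i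
      proof -
        have ev: "even (2 ^ i :: nat)" using i by auto
        have "0 = real_of_int (poly (H W i) x)" using H0[OF i] by simp
        also have "\<dots> = (\<Sum>v\<in>?S. real_of_int (c v * sg W v) * real_of_int (poly (N v) x) ^ 2 ^ i)"
          by (simp add: H_def poly_sum poly_power)
        also have "\<dots> = (\<Sum>v\<in>?S. real_of_int (c v * sg W v) * y v ^ 2 ^ i)"
          unfolding y_def using ev by (simp add: power_even_abs)
        finally show ?thesis ..
      qed
    qed (use fS cSV x1 SV in \<open>auto simp: y_def\<close>)
    then have "c v0 = 0" using v0 by (auto simp: sg_def split: if_splits)
    then show False using v0 by (simp add: S_def)
  qed
  define i where "i W = (SOME i. i \<in> {1..card V} \<and> H W i \<noteq> 0)" for W
  have i: "i W \<in> {1..card V}" "H W (i W) \<noteq> 0" for W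
    using someI_ex[of "\<lambda>i. i \<in> {1..card V} \<and> H W i \<noteq> 0"] exi[of W] unfolding i_def by blast+
  define K where "K = (\<Prod>U\<in>?Us. G U) * (\<Prod>W\<in>Pow ?S. H W (i W))"
  have fUs: "finite ?Us" by (rule finite_subset[of _ "Pow ?S"]) (use fS in auto)
  have "K \<noteq> 0"
    unfolding K_def mult_eq_0_iff prod_zero_iff[OF fUs] prod_zero_iff[OF finite_Pow_iff[THEN iffD2, OF fS]]
    using G0 i(2) by blast
  \<comment> \<open>There are at most \<open>2 ^ card V\<close> factors of each kind, of degree at
    most \<open>D\<close> for \<open>G\<close> and, as \<open>i W \<le> card V\<close>, at most
    \<open>2 ^ card V * D\<close> for \<open>H\<close>.\<close>
  moreover have "Polynomial.degree K \<le> 2 * 4 ^ card V * D"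
  proof -
    have dG: "Polynomial.degree (G U) \<le> D" if "U \<in> ?Us" for U
      unfolding G_def using that SV deg fS
      by (intro degree_sum_le order_trans[OF degree_smult_le]) (auto intro: finite_subset[OF _ fS])
    have dH: "Polynomial.degree (H W (i W)) \<le> 2 ^ card V * D" for W
      unfolding H_def
    proof (intro degree_sum_le fS)
      fix v assume v: "v \<in> ?S"
      have "Polynomial.degree (Polynomial.smult (c v * sg W v) (N v ^ 2 ^ i W)) \<le> Polynomial.degree (N v ^ 2 ^ i W)"
        by (rule degree_smult_le)
      also have "\<dots> \<le> Polynomial.degree (N v) * 2 ^ i W" by (rule degree_power_le)
      also have "\<dots> \<le> D * 2 ^ card V" using v SV deg i(1)[of W] by (intro mult_mono power_increasing) auto
      finally show "Polynomial.degree (Polynomial.smult (c v * sg W v) (N v ^ 2 ^ i W)) \<le> 2 ^ card V * D"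
        by (simp add: mult.commute)
    qed
    have "Polynomial.degree K \<le> Polynomial.degree (\<Prod>U\<in>?Us. G U) + Polynomial.degree (\<Prod>W\<in>Pow ?S. H W (i W))"
      unfolding K_def by (rule degree_mult_le)
    also have "\<dots> \<le> (\<Sum>U\<in>?Us. Polynomial.degree (G U)) + (\<Sum>W\<in>Pow ?S. Polynomial.degree (H W (i W)))"
      using degree_prod_sum_le[OF fUs, of G] degree_prod_sum_le[of "Pow ?S" "\<lambda>W. H W (i W)"] fS
      by (intro add_mono) (auto simp: o_def)
    also have "\<dots> \<le> card ?Us * D + card (Pow ?S) * (2 ^ card V * D)"
      using dG dH by (intro add_mono sum_bounded_above[where 'a = nat, simplified]) auto
    also have "\<dots> \<le> 2 ^ card V * D + 2 ^ card V * (2 ^ card V * D)"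
    proof -
      have 1: "card (Pow ?S) \<le> 2 ^ card V" using cSV fS by (simp add: card_Pow)
      have "card ?Us \<le> card (Pow ?S)" using fS by (intro card_mono) auto
      with 1 have "card ?Us \<le> 2 ^ card V" by simp
      with 1 show ?thesis by (intro add_mono mult_right_mono) auto
    qed
    also have "(2::nat) ^ card V * D + 2 ^ card V * (2 ^ card V * D) \<le> 2 * 4 ^ card V * D"
    proof -
      have "(4::nat) ^ card V = 2 ^ card V * 2 ^ card V" by (simp flip: power_mult_distrib)
      moreover have "(2::nat) ^ card V \<le> 2 ^ card V * 2 ^ card V" by simp
      then have "(2::nat) ^ card V * D \<le> 2 ^ card V * 2 ^ card V * D" by (rule mult_le_mono1)
      ultimately show ?thesis by simp
    qed
    finally show ?thesis by simp
  qed
  moreover have "poly (of_int_poly K) x = 0"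
    if x0: "\<forall>v\<in>V. poly (of_int_poly (N v)) x \<noteq> 0"
      and tor: "\<forall>v\<in>V. \<forall>w\<in>V. \<exists>n>0. poly (of_int_poly (N v)) x ^ n = poly (of_int_poly (N w)) x ^ n"
    for x :: complex
  proof -
    let ?e = "\<lambda>v. poly (of_int_poly (N v)) x"
    \<comment> \<open>Only ratios of the values are known to be roots of unity. Dividing by the
      value of \<open>N v0\<close> gives \<open>t v0 = 1\<close>, and by homogeneity the division
      can be undone in \<open>G U\<close> and \<open>H W i\<close>.\<close>
    define t where "t v = ?e v / ?e v0" for v
    have e0: "?e v0 \<noteq> 0" using x0 v0 SV by blast
    have et: "?e v = t v * ?e v0" for v using e0 by (simp add: t_def)
    have "(\<exists>U. U \<subset> ?S \<and> v0 \<in> U \<and> (\<Sum>v\<in>U. of_int (c v) * t v) = 0) \<or>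
      (\<exists>d. (\<forall>v\<in>?S. d v \<in> {1, -1}) \<and> (\<forall>i\<ge>1. (\<Sum>v\<in>?S. of_int (c v * d v) * t v ^ (2 ^ i)) = 0))"
    proof (rule roots_of_unity_relation[OF fS v0])
      show "t v0 = 1" using e0 by (simp add: t_def)
      show "\<exists>n>0. t v ^ n = 1" if v: "v \<in> ?S" for v
      proof -
        obtain n where n: "n > 0" "?e v ^ n = ?e v0 ^ n" using tor v v0 SV by blast
        then have "t v ^ n = 1" using e0 by (simp add: t_def power_divide)
        then show ?thesis using n by blast
      qed
      have "0 = poly (of_int_poly (\<Sum>v\<in>?S. Polynomial.smult (c v) (N v))) x" by (simp add: relS)
      also have "\<dots> = (\<Sum>v\<in>?S. of_int (c v) * t v) * ?e v0"
        by (simp add: hom_distribs poly_sum sum_distrib_right et[symmetric] mult.assoc)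
      finally show "(\<Sum>v\<in>?S. of_int (c v) * t v) = 0" using e0 by simp
    qed
    then consider U where "U \<subset> ?S" "v0 \<in> U" "(\<Sum>v\<in>U. of_int (c v) * t v) = 0"
      | d where "\<forall>v\<in>?S. d v \<in> {1, -1}" "\<forall>i\<ge>1. (\<Sum>v\<in>?S. of_int (c v * d v) * t v ^ (2 ^ i)) = 0"
      by blast
    then show ?thesis
    proof cases
      case 1
      have "poly (of_int_poly (G U)) x = (\<Sum>v\<in>U. of_int (c v) * t v) * ?e v0"
        by (simp add: G_def hom_distribs poly_sum sum_distrib_right et[symmetric] mult.assoc)
      then have "poly (of_int_poly (G U)) x = 0" using 1 by simp
      moreover have "G U dvd K" unfolding K_def using 1 fUs by (intro dvd_mult2 dvd_prodI) auto
      ultimately show ?thesis by (auto elim!: dvdE simp: hom_distribs)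
    next
      case 2
      define W where "W = {v\<in>?S. d v = -1}"
      have dW: "d v = sg W v" if "v \<in> ?S" for v using 2(1) that by (auto simp: sg_def W_def)
      have "poly (of_int_poly (H W (i W))) x = (\<Sum>v\<in>?S. of_int (c v * d v) * t v ^ 2 ^ i W) * ?e v0 ^ 2 ^ i W"
        unfolding H_def sum_distrib_right
        by (simp add: hom_distribs poly_sum dW) (intro sum.cong refl, subst et, simp add: power_mult_distrib)
      then have "poly (of_int_poly (H W (i W))) x = 0" using 2(2) i(1)[of W] by simp
      moreover have "H W (i W) dvd K" unfolding K_def using fS
        by (intro dvd_mult dvd_prodI) (auto simp: W_def)
      ultimately show ?thesis by (auto elim!: dvdE simp: hom_distribs)
    qed
  qed
  ultimately show ?thesis by blast
qed

text \<open>The degree bound of \<open>torsion_cover\<close> for \<open>(2 * d + 2) ^ 2\<close>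
  polynomials of degree at most \<open>2 * d * (2 * d + 1)\<close>.\<close>

definition torsion_bound :: "nat \<Rightarrow> nat" where
  "torsion_bound d = 2 * 4 ^ ((2 * d + 2) * (2 * d + 2)) * (2 * d * (2 * d + 1))"

text \<open>The monomials in \<open>P / Q\<close> and \<open>R / W\<close> of degree at most \<open>2 * d + 1\<close> in each of
  them are more numerous than the coefficients of their numerators over a common denominator.\<close>
lemma torsion_cover_pair:
  fixes P Q R W :: "int poly"
  assumes nz: "P \<noteq> 0" "Q \<noteq> 0" "R \<noteq> 0" "W \<noteq> 0"
    and deg: "Polynomial.degree P \<le> d" "Polynomial.degree Q \<le> d" "Polynomial.degree R \<le> d" "Polynomial.degree W \<le> d"
    and indep: "\<And>a a' b b'. P ^ a * Q ^ a' * R ^ b * W ^ b' = Q ^ a * P ^ a' * W ^ b * R ^ b' \<Longrightarrow> a = a' \<and> b = b'"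
  shows "\<exists>K. K \<noteq> 0 \<and> Polynomial.degree K \<le> torsion_bound d \<and>
    (\<forall>(x::complex) s t. s > 0 \<longrightarrow> t > 0 \<longrightarrow>
      poly (of_int_poly P) x \<noteq> 0 \<longrightarrow> poly (of_int_poly R) x \<noteq> 0 \<longrightarrow>
      poly (of_int_poly P) x ^ s = poly (of_int_poly Q) x ^ s \<longrightarrow>
      poly (of_int_poly R) x ^ t = poly (of_int_poly W) x ^ t \<longrightarrow>
      poly (of_int_poly K) x = 0)"
proof -
  define M where "M = 2 * d + 1"
  define V where "V = {0..M} \<times> {0..M}"
  define N where "N = (\<lambda>(e, h). (P ^ e * Q ^ (M - e)) * (R ^ h * W ^ (M - h)))"
  have cV: "card V = (2 * d + 2) * (2 * d + 2)" by (simp add: V_def M_def)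
  have "\<exists>K. K \<noteq> 0 \<and> Polynomial.degree K \<le> 2 * 4 ^ card V * (2 * d * M) \<and>
    (\<forall>x::complex. (\<forall>v\<in>V. poly (of_int_poly (N v)) x \<noteq> 0) \<longrightarrow>
      (\<forall>v\<in>V. \<forall>w\<in>V. \<exists>n>0. poly (of_int_poly (N v)) x ^ n = poly (of_int_poly (N w)) x ^ n) \<longrightarrow>
      poly (of_int_poly K) x = 0)"
  proof (rule torsion_cover)
    show "finite V" by (simp add: V_def)
    show "Suc (2 * d * M) < card V" unfolding cV by (simp add: M_def algebra_simps)
    show "N v \<noteq> 0" for v using nz by (auto simp: N_def split: prod.split)
    show "Polynomial.degree (N v) \<le> 2 * d * M" if v: "v \<in> V" for v
    proof -
      obtain e h where eh: "v = (e, h)" "e \<le> M" "h \<le> M" using v by (auto simp: V_def)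
      have aux: "Polynomial.degree (A ^ k * B ^ (M - k)) \<le> d * M"
        if "Polynomial.degree A \<le> d" "Polynomial.degree B \<le> d" "k \<le> M" for A B :: "int poly" and k
      proof -
        have "Polynomial.degree (A ^ k * B ^ (M - k)) \<le> Polynomial.degree A * k + Polynomial.degree B * (M - k)"
          by (intro order_trans[OF degree_mult_le] add_mono degree_power_le)
        also have "\<dots> \<le> d * k + d * (M - k)" using that by (intro add_mono mult_right_mono) auto
        also have "\<dots> = d * M" using that(3) by (simp flip: distrib_left)
        finally show ?thesis .
      qed
      have "Polynomial.degree (N v) \<le> d * M + d * M"
        unfolding eh N_def prod.case
        by (rule order_trans[OF degree_mult_le add_mono]) (use deg eh aux in auto)
      then show ?thesis by simp
    qed
    show "N v ^ 2 \<noteq> N w ^ 2" if v: "v \<in> V" "w \<in> V" "v \<noteq> w" for v w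
    proof
      assume eq: "N v ^ 2 = N w ^ 2"
      obtain e h where eh: "v = (e, h)" "e \<le> M" "h \<le> M" using v by (auto simp: V_def)
      obtain e' h' where eh': "w = (e', h')" "e' \<le> M" "h' \<le> M" using v by (auto simp: V_def)
      \<comment> \<open>\<open>N (i, j)\<close> is the monomial
        \<open>(P / Q) ^ i * (R / W) ^ j\<close> times the common denominator
        \<open>Q ^ M * W ^ M\<close>. Equal squares therefore give a multiplicative relation between
        \<open>P / Q\<close> and \<open>R / W\<close> with exponents \<open>2 * (e - e')\<close> and
        \<open>2 * (h - h')\<close>.\<close>
      have N: "N (i, j) * (Q ^ i * W ^ j) = P ^ i * R ^ j * (Q ^ M * W ^ M)" if "i \<le> M" "j \<le> M" for i j
      proof -
        have "Q ^ M = Q ^ (M - i) * Q ^ i" "W ^ M = W ^ (M - j) * W ^ j"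
          using that by (simp_all flip: power_add)
        then show ?thesis by (simp add: N_def algebra_simps)
      qed
      let ?c = "(Q ^ M * W ^ M) ^ 2"
      have "P ^ (2 * e) * Q ^ (2 * e') * R ^ (2 * h) * W ^ (2 * h') * ?c =
          (P ^ e * R ^ h * (Q ^ M * W ^ M)) ^ 2 * (Q ^ e' * W ^ h') ^ 2"
        by (simp add: power_mult_distrib power_mult[symmetric] mult.commute mult.left_commute)
      also have "\<dots> = N v ^ 2 * (Q ^ e * W ^ h * (Q ^ e' * W ^ h')) ^ 2"
        unfolding N[OF eh(2,3), symmetric] eh(1) by (simp add: power_mult_distrib mult_ac)
      also have "\<dots> = N w ^ 2 * (Q ^ e' * W ^ h' * (Q ^ e * W ^ h)) ^ 2" by (simp add: eq mult_ac)
      also have "\<dots> = (P ^ e' * R ^ h' * (Q ^ M * W ^ M)) ^ 2 * (Q ^ e * W ^ h) ^ 2"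
        unfolding N[OF eh'(2,3), symmetric] eh'(1) by (simp add: power_mult_distrib mult_ac)
      also have "\<dots> = Q ^ (2 * e) * P ^ (2 * e') * W ^ (2 * h) * R ^ (2 * h') * ?c"
        by (simp add: power_mult_distrib power_mult[symmetric] mult.commute mult.left_commute)
      finally have "P ^ (2 * e) * Q ^ (2 * e') * R ^ (2 * h) * W ^ (2 * h') =
          Q ^ (2 * e) * P ^ (2 * e') * W ^ (2 * h) * R ^ (2 * h')" using nz by simp
      then have "2 * e = 2 * e' \<and> 2 * h = 2 * h'" by (rule indep)
      then show False using v eh eh' by simp
    qed
  qed
  then obtain K where K: "K \<noteq> 0" "Polynomial.degree K \<le> 2 * 4 ^ card V * (2 * d * M)"
    "\<And>x::complex. (\<forall>v\<in>V. poly (of_int_poly (N v)) x \<noteq> 0) \<Longrightarrow>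
      (\<forall>v\<in>V. \<forall>w\<in>V. \<exists>n>0. poly (of_int_poly (N v)) x ^ n = poly (of_int_poly (N w)) x ^ n) \<Longrightarrow>
      poly (of_int_poly K) x = 0" by blast
  have "poly (of_int_poly K) x = 0"
    if st: "s > 0" "t > 0" and x: "poly (of_int_poly P) x \<noteq> 0" "poly (of_int_poly R) x \<noteq> 0"
      and PQ: "poly (of_int_poly P) x ^ s = poly (of_int_poly Q) x ^ s"
      and RW: "poly (of_int_poly R) x ^ t = poly (of_int_poly W) x ^ t" for x :: complex and s t
  proof (rule K(3))
    let ?P = "poly (of_int_poly P) x" and ?Q = "poly (of_int_poly Q) x"
      and ?R = "poly (of_int_poly R) x" and ?W = "poly (of_int_poly W) x"
    have x': "?Q \<noteq> 0" "?W \<noteq> 0" using x PQ RW st by (metis power_eq_0_iff)+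
    have eN: "poly (of_int_poly (N (e, h))) x = ?P ^ e * ?Q ^ (M - e) * (?R ^ h * ?W ^ (M - h))" for e h
      by (simp add: N_def hom_distribs)
    show "\<forall>v\<in>V. poly (of_int_poly (N v)) x \<noteq> 0" using x x' eN by auto
    have "?P ^ (s * t) = ?Q ^ (s * t)" using PQ by (simp add: power_mult)
    moreover have "?R ^ (s * t) = ?W ^ (s * t)" using RW by (metis power_mult mult.commute)
    \<comment> \<open>At \<open>x\<close> both \<open>P / Q\<close> and \<open>R / W\<close> are
      roots of unity of order dividing \<open>s * t\<close>, so the \<open>(s * t)\<close>-th power
      of the value of \<open>N (e, h)\<close> is independent of \<open>e\<close> and
      \<open>h\<close>.\<close>
    ultimately have "(?P ^ e * ?Q ^ (M - e) * (?R ^ h * ?W ^ (M - h))) ^ (s * t) = ?Q ^ (M * (s * t)) * ?W ^ (M * (s * t))"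
      if "e \<le> M" "h \<le> M" for e h
    proof -
      assume 1: "?P ^ (s * t) = ?Q ^ (s * t)" and 2: "?R ^ (s * t) = ?W ^ (s * t)"
      have "(?P ^ e * ?Q ^ (M - e) * (?R ^ h * ?W ^ (M - h))) ^ (s * t)
        = (?P ^ (s * t)) ^ e * (?Q ^ (s * t)) ^ (M - e) * ((?R ^ (s * t)) ^ h * (?W ^ (s * t)) ^ (M - h))"
        by (simp only: power_mult_distrib power_mult[symmetric] mult.commute)
      also have "\<dots> = ?Q ^ (s * t * e + s * t * (M - e)) * ?W ^ (s * t * h + s * t * (M - h))"
        unfolding 1 2 by (simp only: power_mult power_add)
      also have "s * t * e + s * t * (M - e) = M * (s * t)" using that by (simp flip: distrib_left)
      also have "s * t * h + s * t * (M - h) = M * (s * t)" using that by (simp flip: distrib_left)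
      finally show ?thesis .
    qed
    then have "poly (of_int_poly (N v)) x ^ (s * t) = ?Q ^ (M * (s * t)) * ?W ^ (M * (s * t))" if "v \<in> V" for v
      using that eN by (auto simp: V_def)
    then show "\<forall>v\<in>V. \<forall>w\<in>V. \<exists>n>0. poly (of_int_poly (N v)) x ^ n = poly (of_int_poly (N w)) x ^ n"
      using st by (metis nat_0_less_mult_iff)
  qed
  then show ?thesis using K(1,2) unfolding cV M_def torsion_bound_def by blast
qed

section \<open>Rational functions as quotients of integer polynomials\<close>

lemma clear_denominators:
  fixes p :: "rat poly"
  shows "\<exists>a P. a \<noteq> 0 \<and> Polynomial.smult (of_int a) p = of_int_poly P \<and> Polynomial.degree P = Polynomial.degree p"
proof -
  obtain a P where aP: "rat_to_int_poly p = (a, P)" by (cases "rat_to_int_poly p")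
  have "p = Polynomial.smult (inverse (of_int a)) (of_int_poly P)" "a > 0" using rat_to_int_poly[OF aP] by auto
  then show ?thesis by (intro exI[of _ a] exI[of _ P]) auto
qed

text \<open>The denominators in \<open>n\<close> and \<open>m\<close> are cleared separately, by
  \<open>a\<close> and \<open>b\<close>; scaling both by \<open>a * b\<close> preserves the
  quotient. Bezout's identity over the rationals excludes common complex zeros.\<close>

lemma ratfun_int_representation:
  fixes f :: ratfun
  defines "n \<equiv> fst (quot_of_fract f)" and "m \<equiv> snd (quot_of_fract f)"
  shows "\<exists>P Q. f = int_poly_to_ratfun P / int_poly_to_ratfun Q \<and> Q \<noteq> 0 \<and>
    Polynomial.degree P = Polynomial.degree n \<and> Polynomial.degree Q = Polynomial.degree m \<and>
    (\<forall>x::complex. \<not> (poly (of_int_poly P) x = 0 \<and> poly (of_int_poly Q) x = 0))"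
proof -
  have m0: "m \<noteq> 0" by (simp add: m_def)
  have f: "f = to_fract n / to_fract m"
    by (metis Fract_conv_to_fract Fract_quot_of_fract n_def m_def)
  obtain a P where P: "a \<noteq> 0" "Polynomial.smult (of_int a) n = of_int_poly P" "Polynomial.degree P = Polynomial.degree n"
    using clear_denominators[of n] by blast
  obtain b Q where Q: "b \<noteq> 0" "Polynomial.smult (of_int b) m = of_int_poly Q" "Polynomial.degree Q = Polynomial.degree m"
    using clear_denominators[of m] by blast
  let ?P = "Polynomial.smult b P" and ?Q = "Polynomial.smult a Q"
  have P': "of_int_poly ?P = Polynomial.smult (of_int (a * b)) n"
    by (simp add: hom_distribs P(2)[symmetric] mult.commute)
  have Q': "of_int_poly ?Q = Polynomial.smult (of_int (a * b)) m"
    by (simp add: hom_distribs Q(2)[symmetric])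
  have "int_poly_to_ratfun ?P / int_poly_to_ratfun ?Q = f"
    unfolding int_poly_to_ratfun_def P' Q' f using m0 P(1) Q(1)
    by (simp add: frac_eq_eq flip: to_fract_mult)
  moreover have "?Q \<noteq> 0" using Q' m0 P(1) Q(1) by auto
  moreover have "\<not> (poly (of_int_poly ?P) x = 0 \<and> poly (of_int_poly ?Q) x = 0)" for x :: complex
  proof
    assume x: "poly (of_int_poly ?P) x = 0 \<and> poly (of_int_poly ?Q) x = 0"
    have of_rat: "(of_int_poly A :: complex poly) = map_poly of_rat (of_int_poly A)" for A
      by (simp add: poly_eq_iff coeff_map_poly)
    have 1: "poly (map_poly of_rat n) x = 0" "poly (map_poly of_rat m) x = 0"
      using x P(1) Q(1) unfolding of_rat P' Q' by (auto simp: hom_distribs)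
    obtain u v where "u * n + v * m = gcd n m" by (metis bezout_coefficients_fst_snd)
    moreover have "gcd n m = 1" using coprime_quot_of_fract[of f] by (simp add: n_def m_def coprime_iff_gcd_eq_1)
    ultimately have "poly (map_poly of_rat (u * n + v * m)) x = (1::complex)" by simp
    moreover have "map_poly complex_of_rat (A * B) = map_poly of_rat A * map_poly of_rat B" for A B
      by (simp add: poly_eq_iff coeff_map_poly Polynomial.coeff_mult of_rat_sum of_rat_mult)
    ultimately show False using 1 by (simp add: hom_distribs)
  qed
  moreover have "Polynomial.degree ?P = Polynomial.degree n" "Polynomial.degree ?Q = Polynomial.degree m"
    using P Q by simp_all
  ultimately show ?thesis by blast
qed

lemma mult_independent_pair:
  assumes ind: "mult_independent \<phi>" and ij: "i < length \<phi>" "j < length \<phi>" "i \<noteq> j"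
    and eq: "\<phi> ! i powi k * \<phi> ! j powi l = 1"
  shows "k = 0 \<and> l = 0"
proof -
  define c where "c r = (if r = i then k else if r = j then l else 0)" for r
  have "(\<Prod>r<length \<phi>. (\<phi> ! r) powi (c r)) = (\<Prod>r\<in>{i, j}. (\<phi> ! r) powi (c r))"
    using ij by (intro prod.mono_neutral_right) (auto simp: c_def)
  also have "\<dots> = 1" using ij eq by (simp add: c_def)
  finally have "\<forall>r<length \<phi>. c r = 0" using ind unfolding mult_independent_def by blast
  then have "c i = 0" "c j = 0" using ij by auto
  then show ?thesis using ij by (simp add: c_def)
qed

lemma int_poly_to_ratfun_mult: "int_poly_to_ratfun (A * B) = int_poly_to_ratfun A * int_poly_to_ratfun B"
  by (simp add: int_poly_to_ratfun_def hom_distribs)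

lemma int_poly_to_ratfun_power: "int_poly_to_ratfun (A ^ n) = int_poly_to_ratfun A ^ n"
  by (induction n) (simp_all add: int_poly_to_ratfun_mult, simp add: int_poly_to_ratfun_def)

lemma int_poly_to_ratfun_eq_0_iff [simp]: "int_poly_to_ratfun A = 0 \<longleftrightarrow> A = 0"
  by (simp add: int_poly_to_ratfun_def)

text \<open>Independence without division: the integer exponents \<open>a - a'\<close> and
  \<open>b - b'\<close> are split into natural numbers, so that the relation can be stated between
  polynomials.\<close>

lemma mult_independent_int_polys:
  assumes ind: "mult_independent \<phi>" and ij: "i < length \<phi>" "j < length \<phi>" "i \<noteq> j"
    and i: "\<phi> ! i = int_poly_to_ratfun P / int_poly_to_ratfun Q"
    and j: "\<phi> ! j = int_poly_to_ratfun R / int_poly_to_ratfun W"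
    and nz: "P \<noteq> 0" "Q \<noteq> 0" "R \<noteq> 0" "W \<noteq> 0"
    and eq: "P ^ a * Q ^ a' * R ^ b * W ^ b' = Q ^ a * P ^ a' * W ^ b * R ^ b'"
  shows "a = a' \<and> b = b'"
proof -
  let ?i = int_poly_to_ratfun
  have "?i P ^ a * ?i Q ^ a' * ?i R ^ b * ?i W ^ b' = ?i Q ^ a * ?i P ^ a' * ?i W ^ b * ?i R ^ b'"
    using arg_cong[OF eq, of ?i] by (simp add: int_poly_to_ratfun_mult int_poly_to_ratfun_power)
  then have "(\<phi> ! i) powi (int a - int a') * (\<phi> ! j) powi (int b - int b') = 1"
    unfolding i j using nz by (simp add: power_int_diff field_simps)
  from mult_independent_pair[OF ind ij this] show ?thesis by simp
qed

section \<open>Common zeros modulo primes\<close>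

lemma coeff_mult_bound:
  fixes P Q :: "int poly"
  assumes "\<And>k. \<bar>Polynomial.coeff Q k\<bar> \<le> B"
  shows "\<bar>Polynomial.coeff (P * Q) k\<bar> \<le> (\<Sum>i\<le>Polynomial.degree P. \<bar>Polynomial.coeff P i\<bar>) * B"
proof -
  have B: "B \<ge> 0" using assms[of 0] by linarith
  have "\<bar>Polynomial.coeff (P * Q) k\<bar> \<le> (\<Sum>i\<le>k. \<bar>Polynomial.coeff P i\<bar> * B)"
    unfolding Polynomial.coeff_mult
    by (rule order_trans[OF sum_abs]) (auto simp: abs_mult intro!: sum_mono mult_left_mono assms)
  also have "\<dots> = (\<Sum>i\<le>k. \<bar>Polynomial.coeff P i\<bar>) * B" by (simp add: sum_distrib_right)
  also have "(\<Sum>i\<le>k. \<bar>Polynomial.coeff P i\<bar>) = (\<Sum>i\<in>{..k} \<inter> {..Polynomial.degree P}. \<bar>Polynomial.coeff P i\<bar>)"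
    by (intro sum.mono_neutral_right) (auto intro: le_degree)
  also have "\<dots> * B \<le> (\<Sum>i\<le>Polynomial.degree P. \<bar>Polynomial.coeff P i\<bar>) * B"
    using B by (intro mult_right_mono sum_mono2) auto
  finally show ?thesis .
qed

lemma coeff_power_bound:
  fixes P :: "int poly"
  shows "\<bar>Polynomial.coeff (P ^ s) k\<bar> \<le> (\<Sum>i\<le>Polynomial.degree P. \<bar>Polynomial.coeff P i\<bar>) ^ s"
proof (induction s arbitrary: k)
  case 0
  then show ?case by (simp add: coeff_1)
next
  case (Suc s)
  show ?case using coeff_mult_bound[OF Suc] by simp
qed

text \<open>Mignotte bounds the coefficients of \<open>g\<close> by its Mahler measure, which is at
  most that of the multiple \<open>f\<close>; Landau bounds the latter by the Euclidean norm of the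
  coefficients.\<close>

lemma coeff_factor_bound:
  fixes f g :: "int poly"
  assumes f: "f \<noteq> 0" "g dvd f" and n: "Polynomial.degree f \<le> n" and H: "\<And>k. \<bar>Polynomial.coeff f k\<bar> \<le> H"
  shows "\<bar>Polynomial.coeff g k\<bar> \<le> 2 ^ n * (int n + 1) * H"
proof -
  have H0: "H \<ge> 0" using H[of 0] by linarith
  have "(\<Sum>a\<leftarrow>coeffs f. a * a) = (\<Sum>i\<le>Polynomial.degree f. Polynomial.coeff f i * Polynomial.coeff f i)"
    using f(1) by (simp add: coeffs_def interv_sum_list_conv_sum_set_nat atLeast0AtMost[symmetric] atLeastLessThanSuc_atLeastAtMost o_def del: upt_Suc)
  also have "\<dots> \<le> (\<Sum>i\<le>Polynomial.degree f. H * H)"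
    using H H0 by (intro sum_mono) (metis abs_ge_zero abs_mult_self_eq mult_mono)
  also have "\<dots> \<le> (int n + 1) * (H * H)" using n by (auto intro!: mult_right_mono)
  \<comment> \<open>One more factor makes the bound a perfect square, so that no square root
    remains.\<close>
  also have "\<dots> \<le> (int n + 1) * (int n + 1) * (H * H)" by (intro mult_right_mono) auto
  finally have sq: "(\<Sum>a\<leftarrow>coeffs f. a * a) \<le> ((int n + 1) * H) ^ 2" by (simp add: power2_eq_square algebra_simps)
  have "mahler_measure f \<le> sqrt (real_of_int (\<Sum>a\<leftarrow>coeffs f. a * a))" by (rule Landau_inequality_mahler_measure)
  also have "\<dots> \<le> sqrt (real_of_int (((int n + 1) * H) ^ 2))" using sq by (simp only: real_sqrt_le_iff of_int_le_iff)
  also have "\<dots> = real_of_int ((int n + 1) * H)" using H0 by (simp add: real_sqrt_mult)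
  finally have mf: "mahler_measure f \<le> real_of_int ((int n + 1) * H)" .
  have "real_of_int \<bar>Polynomial.coeff g k\<bar> \<le> real (Polynomial.degree g choose k) * mahler_measure g"
    by (rule Mignotte_bound)
  also have "\<dots> \<le> 2 ^ n * mahler_measure f"
  proof (intro mult_mono mahler_measure_dvd[OF f] mahler_measure_ge_0)
    have "Polynomial.degree g choose k \<le> 2 ^ Polynomial.degree g" by (rule binomial_le_pow2)
    also have "(2::nat) ^ Polynomial.degree g \<le> 2 ^ n"
      using dvd_imp_degree_le[OF f(2,1)] n by (intro power_increasing) auto
    finally have "real (Polynomial.degree g choose k) \<le> real (2 ^ n)" by (simp only: of_nat_le_iff)
    then show "real (Polynomial.degree g choose k) \<le> 2 ^ n" by simp
  qed auto
  also have "\<dots> \<le> 2 ^ n * real_of_int ((int n + 1) * H)" using mf by simp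
  also have "\<dots> = real_of_int (2 ^ n * (int n + 1) * H)" by simp
  finally show ?thesis by (simp only: of_int_le_iff)
qed

text \<open>The Leibniz expansion of the Sylvester determinant has \<open>N!\<close> terms of size
  at most \<open>H ^ N\<close>, and \<open>N! \<le> N ^ N\<close>.\<close>

lemma resultant_bound:
  fixes f g :: "int poly"
  assumes "\<And>k. \<bar>Polynomial.coeff f k\<bar> \<le> H" "\<And>k. \<bar>Polynomial.coeff g k\<bar> \<le> H"
    and N: "N = Polynomial.degree f + Polynomial.degree g"
  shows "\<bar>resultant f g\<bar> \<le> (int N * H) ^ N"
proof -
  have H: "H \<ge> 0" using assms(1)[of 0] by linarith
  let ?S = "sylvester_mat f g"
  have S: "?S \<in> carrier_mat N N" unfolding N by (rule sylvester_carrier_mat)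
  have ent: "\<bar>?S $$ (i, j)\<bar> \<le> H" if "i < N" "j < N" for i j
    using that assms(1,2) H unfolding N by (subst sylvester_index_mat) auto
  have "\<bar>resultant f g\<bar> \<le> (\<Sum>p\<in>{p. p permutes {0..<N}}. \<bar>signof p * (\<Prod>i=0..<N. ?S $$ (i, p i))\<bar>)"
    unfolding resultant_def det_def'[OF S] by (rule sum_abs)
  also have "\<dots> \<le> (\<Sum>p\<in>{p. p permutes {0..<N}}. H ^ N)"
  proof (intro sum_mono)
    fix p assume p: "p \<in> {p. p permutes {0..<N}}"
    have "\<bar>signof p * (\<Prod>i=0..<N. ?S $$ (i, p i))\<bar> = (\<Prod>i=0..<N. \<bar>?S $$ (i, p i)\<bar>)"
      by (simp add: abs_mult abs_prod sign_def)
    also have "\<dots> \<le> (\<Prod>i=0..<N. H)"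
    proof (intro prod_mono conjI)
      fix i assume i: "i \<in> {0..<N}"
      then have "p i < N" using p by (metis atLeastLessThan_iff mem_Collect_eq permutes_in_image)
      then show "\<bar>?S $$ (i, p i)\<bar> \<le> H" using i ent by auto
    qed auto
    finally show "\<bar>signof p * (\<Prod>i=0..<N. ?S $$ (i, p i))\<bar> \<le> H ^ N" by simp
  qed
  also have "\<dots> = int (fact N) * H ^ N" by (simp add: card_permutations[of "{0..<N}" N])
  also have "\<dots> \<le> int N ^ N * H ^ N"
  proof (intro mult_right_mono)
    have "fact N \<le> N ^ N" using fact_le_power[of N, where 'a = nat] by simp
    then have "int (fact N) \<le> int (N ^ N)" by (simp only: of_nat_le_iff)
    then show "int (fact N) \<le> int N ^ N" by simp
  qed (use H in auto)
  finally show ?thesis by (simp add: power_mult_distrib)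
qed

text \<open>Each distinct prime divisor contributes a factor of at least 2 to
  \<open>r\<close>.\<close>

lemma card_prime_divisors_le:
  fixes r :: int
  assumes "r \<noteq> 0" "\<bar>r\<bar> \<le> 2 ^ E"
  shows "finite {p::nat. Factorial_Ring.prime p \<and> int p dvd r}" "card {p::nat. Factorial_Ring.prime p \<and> int p dvd r} \<le> E"
proof -
  have r: "nat \<bar>r\<bar> \<noteq> 0" using assms by simp
  have eq: "{p::nat. Factorial_Ring.prime p \<and> int p dvd r} = prime_factors (nat \<bar>r\<bar>)"
    using r by (auto simp: prime_factors_dvd dvd_nat_abs_iff)
  show "finite {p::nat. Factorial_Ring.prime p \<and> int p dvd r}" unfolding eq by simp
  have "(2::nat) ^ card (prime_factors (nat \<bar>r\<bar>)) = (\<Prod>p\<in>prime_factors (nat \<bar>r\<bar>). 2)" by simp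
  also have "\<dots> \<le> (\<Prod>p\<in>prime_factors (nat \<bar>r\<bar>). p ^ multiplicity p (nat \<bar>r\<bar>))"
  proof (intro prod_mono conjI)
    fix p assume p: "p \<in> prime_factors (nat \<bar>r\<bar>)"
    have "2 \<le> p" using p by (auto intro: prime_ge_2_nat)
    also have "p ^ 1 \<le> p ^ multiplicity p (nat \<bar>r\<bar>)"
      using p by (intro power_increasing) (auto simp: prime_factors_multiplicity Suc_le_eq intro: prime_gt_0_nat Suc_leI)
    finally show "2 \<le> p ^ multiplicity p (nat \<bar>r\<bar>)" by simp
  qed auto
  also have "\<dots> = nat \<bar>r\<bar>" using r by (intro prime_factorization_nat[symmetric]) simp
  also have "\<dots> \<le> 2 ^ E" using assms(2) by (simp add: nat_le_iff)
  finally show "card {p::nat. Factorial_Ring.prime p \<and> int p dvd r} \<le> E" unfolding eq by simp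
qed

section \<open>Zeros of integer polynomials in the algebraic closure of a prime field\<close>

context
  fixes p :: nat and a
  assumes p: "Factorial_Ring.prime p" and a: "a \<in> carrier (Fp_bar p)"
begin

interpretation L: field "Fp_bar p" by (rule Fp_bar_field(1)[OF p])

lemma eval_Fp_bar_const:
  shows "eval_Fp_bar p [:c:] a = [c] \<cdot>\<^bsub>Fp_bar p\<^esub> \<one>\<^bsub>Fp_bar p\<^esub>"
proof -
  have "[c] \<cdot>\<^bsub>Fp_bar p\<^esub> \<one>\<^bsub>Fp_bar p\<^esub> \<in> carrier (Fp_bar p)" by (intro L.add.int_pow_closed L.one_closed)
  then show ?thesis
    unfolding eval_Fp_bar_pCons[OF p a, of c 0] eval_Fp_bar_0[OF p a] L.r_null[OF a] by (rule L.r_zero)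
qed

lemma eval_Fp_bar_1:
  shows "eval_Fp_bar p 1 a = \<one>\<^bsub>Fp_bar p\<^esub>" 
proof -
  have "[(1::int)] \<cdot>\<^bsub>Fp_bar p\<^esub> \<one>\<^bsub>Fp_bar p\<^esub> = \<one>\<^bsub>Fp_bar p\<^esub>" by (intro L.add.int_pow_1) simp
  then show ?thesis using eval_Fp_bar_const[of 1] by (simp only: pCons_one)
qed

lemma eval_Fp_bar_mult_eq_0_iff:
  shows "eval_Fp_bar p (A * B) a = \<zero>\<^bsub>Fp_bar p\<^esub> \<longleftrightarrow> eval_Fp_bar p A a = \<zero>\<^bsub>Fp_bar p\<^esub> \<or> eval_Fp_bar p B a = \<zero>\<^bsub>Fp_bar p\<^esub>"
proof -
  show ?thesis using eval_Fp_bar_closed[OF p a] by (simp add: eval_Fp_bar_mult[OF p a] L.integral_iff)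
qed

lemma eval_Fp_bar_dvd:
  assumes "A dvd B" "eval_Fp_bar p A a = \<zero>\<^bsub>Fp_bar p\<^esub>"
  shows "eval_Fp_bar p B a = \<zero>\<^bsub>Fp_bar p\<^esub>"
  using assms by (auto elim!: dvdE simp: eval_Fp_bar_mult_eq_0_iff)

lemma eval_Fp_bar_lin_comb_eq_0:
  assumes "eval_Fp_bar p A a = \<zero>\<^bsub>Fp_bar p\<^esub>" "eval_Fp_bar p B a = \<zero>\<^bsub>Fp_bar p\<^esub>"
  shows "eval_Fp_bar p (U * A + V * B) a = \<zero>\<^bsub>Fp_bar p\<^esub>"
  using assms eval_Fp_bar_closed[OF p a] by (simp add: eval_Fp_bar_add[OF p a] eval_Fp_bar_mult[OF p a])

text \<open>Otherwise Bezout's identity \<open>u * int p + v * c = 1\<close> would give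
  \<open>1 = 0\<close> in the field.\<close>

lemma eval_Fp_bar_const_eq_0D:
  assumes z: "eval_Fp_bar p [:c:] a = \<zero>\<^bsub>Fp_bar p\<^esub>"
  shows "int p dvd c"
proof (rule ccontr)
  assume n: "\<not> int p dvd c"
  have "gcd (int p) c = 1" using p n by (simp add: prime_imp_coprime flip: coprime_iff_gcd_eq_1)
  moreover obtain u v where "u * int p + v * c = gcd (int p) c" by (metis bezout_int)
  ultimately have "u * int p + v * c = 1" by simp
  moreover have "[:u:] * [:int p:] + [:v:] * [:c:] = [:u * int p + v * c:]" by simp
  ultimately have "[:u:] * [:int p:] + [:v:] * [:c:] = 1" by (simp only: pCons_one)
  moreover have "eval_Fp_bar p [:int p:] a = \<zero>\<^bsub>Fp_bar p\<^esub>"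
    using Fp_bar_field(2)[OF p] by (simp add: eval_Fp_bar_const)
  then have "eval_Fp_bar p ([:u:] * [:int p:] + [:v:] * [:c:]) a = \<zero>\<^bsub>Fp_bar p\<^esub>"
    using z by (intro eval_Fp_bar_lin_comb_eq_0)
  ultimately show False using eval_Fp_bar_1 by simp
qed

text \<open>Some prime factor \<open>q\<close> of \<open>D\<close> vanishes at \<open>a\<close>. It
  is not constant, since otherwise \<open>p\<close> would divide it and hence the leading
  coefficient of \<open>D\<close>. So it has a complex zero, which is shared with \<open>K\<close>,
  and therefore \<open>q\<close> divides \<open>K\<close>.\<close>

lemma eval_Fp_bar_eq_0_transfer:
  assumes D: "D \<noteq> 0" "\<not> int p dvd lead_coeff D" "eval_Fp_bar p D a = \<zero>\<^bsub>Fp_bar p\<^esub>"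
    and roots: "\<And>x::complex. poly (of_int_poly D) x = 0 \<Longrightarrow> poly (of_int_poly K) x = 0"
  shows "eval_Fp_bar p K a = \<zero>\<^bsub>Fp_bar p\<^esub>"
  using D roots
proof (induction D rule: prime_divisors_induct)
  case (unit D)
  have "eval_Fp_bar p 1 a = \<zero>\<^bsub>Fp_bar p\<^esub>" by (rule eval_Fp_bar_dvd[of D]) (use unit in auto)
  then show ?case by (simp add: eval_Fp_bar_1)
next
  case (factor q D)
  from factor.prems(3) consider "eval_Fp_bar p q a = \<zero>\<^bsub>Fp_bar p\<^esub>" | "eval_Fp_bar p D a = \<zero>\<^bsub>Fp_bar p\<^esub>"
    by (auto simp: eval_Fp_bar_mult_eq_0_iff)
  then show ?case
  proof cases
    case 1
    have "Polynomial.degree q \<noteq> 0"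
    proof
      assume "Polynomial.degree q = 0"
      then obtain c where c: "q = [:c:]" by (metis degree_eq_zeroE)
      then have "int p dvd c" using 1 eval_Fp_bar_const_eq_0D by blast
      then have "int p dvd lead_coeff (q * D)" unfolding lead_coeff_mult by (simp add: c)
      with factor.prems(2) show False by blast
    qed
    then have "\<not> constant (poly (of_int_poly q :: complex poly))"
      by (simp add: constant_degree)
    then obtain x where x: "poly (of_int_poly q) x = (0::complex)" using fundamental_theorem_of_algebra by blast
    then have "poly (of_int_poly K) x = 0" using factor.prems(4)[of x] by (simp add: hom_distribs)
    then have "q dvd K" using x factor.hyps by (intro prime_elem_dvd_of_common_root[of q x]) auto
    then show ?thesis using 1 by (rule eval_Fp_bar_dvd)
  next
    case 2
    show ?thesis
    proof (rule factor.IH)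
      show "D \<noteq> 0" "\<not> int p dvd lead_coeff D" using factor.prems(1,2) by (auto simp: lead_coeff_mult)
      show "poly (of_int_poly K) x = 0" if "poly (of_int_poly D) x = 0" for x :: complex
        using that factor.prems(4)[of x] by (simp add: hom_distribs)
    qed (use 2 in auto)
  qed
qed auto

end

text \<open>Let \<open>A'\<close> and \<open>B'\<close> be the cofactors of \<open>gcd A B\<close>.
  If \<open>p\<close> does not divide their resultant or the leading coefficient of
  \<open>A\<close>, they have no common zero modulo \<open>p\<close>. Then \<open>a\<close> is a
  zero of the gcd, whose complex zeros are zeros of \<open>K\<close>.\<close>

lemma common_zeros_mod_primes:
  fixes A B K :: "int poly"
  assumes nz: "A \<noteq> 0" "B \<noteq> 0" and n: "Polynomial.degree A \<le> n" "Polynomial.degree B \<le> n"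
    and h: "\<And>k. \<bar>Polynomial.coeff A k\<bar> \<le> 2 ^ h" "\<And>k. \<bar>Polynomial.coeff B k\<bar> \<le> 2 ^ h"
    and roots: "\<And>x::complex. poly (of_int_poly A) x = 0 \<Longrightarrow> poly (of_int_poly B) x = 0 \<Longrightarrow> poly (of_int_poly K) x = 0"
  shows "\<exists>r. r \<noteq> 0 \<and> \<bar>r\<bar> \<le> 2 ^ ((3 * n + h) * (2 * n) + h) \<and>
    (\<forall>p a. Factorial_Ring.prime p \<longrightarrow> \<not> int p dvd r \<longrightarrow> a \<in> carrier (Fp_bar p) \<longrightarrow>
      eval_Fp_bar p A a = \<zero>\<^bsub>Fp_bar p\<^esub> \<longrightarrow> eval_Fp_bar p B a = \<zero>\<^bsub>Fp_bar p\<^esub> \<longrightarrow>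
      eval_Fp_bar p K a = \<zero>\<^bsub>Fp_bar p\<^esub>)"
proof -
  let ?D = "gcd A B"
  have D0: "?D \<noteq> 0" using nz by simp
  obtain A' B' where AB: "A = ?D * A'" "B = ?D * B'" by (metis gcd_dvd1 gcd_dvd2 dvdE)
  have nz': "A' \<noteq> 0" "B' \<noteq> 0" using nz AB by auto
  have g1: "gcd A' B' = 1"
  proof -
    have "gcd A B = normalize (?D * gcd A' B')" using AB by (metis gcd_mult_left normalize_mult)
    then have "?D * 1 = ?D * gcd A' B'"
      by (metis gcd_mult_left AB mult.right_neutral normalize_mult normalize_gcd)
    then show ?thesis using D0 by (metis mult_left_cancel)
  qed
  define r where "r = resultant A' B' * lead_coeff A"
  have r0: "r \<noteq> 0" using nz g1 by (simp add: r_def resultant_0_gcd)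
  define N where "N = Polynomial.degree A' + Polynomial.degree B'"
  have dvd: "A' dvd A" "B' dvd B" using AB by (metis dvd_triv_right)+
  have N: "N \<le> 2 * n" using dvd_imp_degree_le[OF dvd(1) nz(1)] dvd_imp_degree_le[OF dvd(2) nz(2)] n
    by (simp add: N_def)
  have rb: "\<bar>r\<bar> \<le> 2 ^ ((3 * n + h) * (2 * n) + h)"
  proof -
    \<comment> \<open>\<open>?H\<close> bounds the coefficients of the factors \<open>A'\<close> and
      \<open>B'\<close>. Both \<open>N \<le> 2 * n\<close> and \<open>n + 1\<close> are at most
      \<open>2 ^ n\<close>, whence \<open>3 * n\<close>; the last summand \<open>h\<close> of the
      exponent pays for the leading coefficient of \<open>A\<close>.\<close>
    let ?H = "2 ^ n * (int n + 1) * 2 ^ h"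
    have "\<bar>resultant A' B'\<bar> \<le> (int N * ?H) ^ N"
      by (rule resultant_bound[OF _ _ N_def]) (use coeff_factor_bound[OF nz(1) dvd(1) n(1) h(1)] coeff_factor_bound[OF nz(2) dvd(2) n(2) h(2)] in auto)
    also have "\<dots> \<le> (2 ^ (3 * n + h)) ^ N"
    proof (cases "N = 0")
      case False
      have "int N \<le> 2 ^ n"
      proof -
        have "2 * n \<le> 2 ^ n" 
        proof (cases n)
          case (Suc m)
          then show ?thesis using mult_le_mono2[OF Suc_leI[OF less_exp[of m]], of 2] by simp
        qed simp
        then have "int N \<le> int (2 ^ n)" using N by linarith
        then show ?thesis by simp
      qed
      moreover have "int n + 1 \<le> int (2 ^ n)" using less_exp[of n] by linarith
      then have "int n + 1 \<le> 2 ^ n" by simp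
      ultimately have "int N * ?H \<le> 2 ^ n * (2 ^ n * 2 ^ n * 2 ^ h)" by (intro mult_mono) auto
      also have "\<dots> = 2 ^ (3 * n + h)" by (simp add: numeral_3_eq_3 power_add)
      finally show ?thesis by (intro power_mono) auto
    qed auto
    also have "\<dots> \<le> (2 ^ (3 * n + h)) ^ (2 * n)" using N by (intro power_increasing) auto
    also have "\<dots> = 2 ^ ((3 * n + h) * (2 * n))" by (simp flip: power_mult)
    finally have "\<bar>r\<bar> \<le> 2 ^ ((3 * n + h) * (2 * n)) * 2 ^ h"
      unfolding r_def abs_mult using h(1) by (intro mult_mono) auto
    then show ?thesis by (simp add: power_add)
  qed
  have "eval_Fp_bar p K a = \<zero>\<^bsub>Fp_bar p\<^esub>"
    if p: "Factorial_Ring.prime p" and pr: "\<not> int p dvd r" and a: "a \<in> carrier (Fp_bar p)"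
      and zA: "eval_Fp_bar p A a = \<zero>\<^bsub>Fp_bar p\<^esub>" and zB: "eval_Fp_bar p B a = \<zero>\<^bsub>Fp_bar p\<^esub>" for p a
  proof -
    have lA: "\<not> int p dvd lead_coeff A" using pr by (auto simp: r_def)
    have lc: "lead_coeff A = lead_coeff ?D * lead_coeff A'" by (metis AB(1) lead_coeff_mult)
    have "eval_Fp_bar p ?D a = \<zero>\<^bsub>Fp_bar p\<^esub>"
    proof (rule ccontr)
      assume "eval_Fp_bar p ?D a \<noteq> \<zero>\<^bsub>Fp_bar p\<^esub>"
      then have z: "eval_Fp_bar p A' a = \<zero>\<^bsub>Fp_bar p\<^esub>" "eval_Fp_bar p B' a = \<zero>\<^bsub>Fp_bar p\<^esub>"
        using zA zB AB eval_Fp_bar_mult_eq_0_iff[OF p a] by metis+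
      show False
      proof (cases "N = 0")
        \<comment> \<open>Both cofactors are constant and the resultant carries no information, but
          the constant \<open>A'\<close> divides the leading coefficient of
          \<open>A\<close>.\<close>
        case True
        then obtain c where c: "A' = [:c:]" by (metis N_def add_is_0 degree_eq_zeroE)
        then have "int p dvd c" using z eval_Fp_bar_const_eq_0D[OF p a] by blast
        then show False using lA lc c by simp
      next
        case False
        then have "\<exists>u v. u * A' + v * B' = [:resultant A' B':]"
          by (intro resultant_eq_combination) (simp add: N_def)
        then obtain u v where "u * A' + v * B' = [:resultant A' B':]" by blast
        moreover have "eval_Fp_bar p (u * A' + v * B') a = \<zero>\<^bsub>Fp_bar p\<^esub>"
          using z by (intro eval_Fp_bar_lin_comb_eq_0[OF p a])
        ultimately have "int p dvd resultant A' B'" using eval_Fp_bar_const_eq_0D[OF p a] by metis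
        then show False using pr by (simp add: r_def)
      qed
    qed
    moreover have "\<not> int p dvd lead_coeff ?D" using lA lc by auto
    moreover have "poly (of_int_poly K) x = 0" if "poly (of_int_poly ?D) x = 0" for x :: complex
    proof (rule roots)
      have "poly (of_int_poly (?D * A')) x = 0" "poly (of_int_poly (?D * B')) x = 0" using that by (simp_all add: hom_distribs)
      then show "poly (of_int_poly A) x = 0" "poly (of_int_poly B) x = 0" by (simp_all flip: AB)
    qed
    ultimately show ?thesis using D0 by (rule_tac eval_Fp_bar_eq_0_transfer[OF p a, of ?D]) auto
  qed
  with r0 rb show ?thesis by blast
qed

context
  fixes p :: nat
  assumes p: "Factorial_Ring.prime p"
begin

interpretation L: field "Fp_bar p" by (rule Fp_bar_field(1)[OF p])

lemma card_zeros_Fp_bar: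
  assumes K: "\<not> [:int p:] dvd K"
  shows "finite {a \<in> carrier (Fp_bar p). eval_Fp_bar p K a = \<zero>\<^bsub>Fp_bar p\<^esub>}" (is "finite ?Z")
    and "card {a \<in> carrier (Fp_bar p). eval_Fp_bar p K a = \<zero>\<^bsub>Fp_bar p\<^esub>} \<le> Polynomial.degree K"
proof -
  let ?c = "\<lambda>c::int. [c] \<cdot>\<^bsub>Fp_bar p\<^esub> \<one>\<^bsub>Fp_bar p\<^esub>"
  \<comment> \<open>Polynomials over the field are lists with the leading coefficient first, hence
    \<open>rev\<close>.\<close>
  define l where "l U = map ?c (rev (coeffs U))" for U :: "int poly"
  have cc: "?c c \<in> carrier (Fp_bar p)" for c by (intro L.add.int_pow_closed L.one_closed)
  have lc: "set (l U) \<subseteq> carrier (Fp_bar p)" for U using cc by (auto simp: l_def)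
  have el: "L.eval (l U) a = eval_Fp_bar p U a" if a: "a \<in> carrier (Fp_bar p)" for U a
  proof (induction U)
    case 0
    then show ?case by (simp add: l_def eval_Fp_bar_0[OF p a])
  next
    case (pCons c U)
    have "l (pCons c U) = l U @ [?c c]" using pCons.hyps by (auto simp: l_def cCons_def)
    then have "L.eval (l (pCons c U)) a = L.eval (l U) a \<otimes>\<^bsub>Fp_bar p\<^esub> a \<oplus>\<^bsub>Fp_bar p\<^esub> ?c c"
      using L.eval_append_aux[OF lc cc a] by simp
    also have "\<dots> = eval_Fp_bar p (pCons c U) a"
      unfolding pCons.IH eval_Fp_bar_pCons[OF p a]
      using eval_Fp_bar_closed[OF p a] cc a by (simp add: L.m_comm L.a_comm)
    finally show ?case .
  qed
  \<comment> \<open>Leading coefficients may vanish modulo \<open>p\<close>; normalisation strips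
    them, so the degree can only drop.\<close>
  define q where "q = L.normalize (l K)"
  have qc: "q \<in> carrier (poly_ring (Fp_bar p))"
    unfolding q_def univ_poly_carrier[symmetric] by (rule L.normalize_gives_polynomial[OF lc])
  have eq: "L.eval q a = eval_Fp_bar p K a" if "a \<in> carrier (Fp_bar p)" for a
    unfolding q_def using L.eval_normalize[OF lc that] el[OF that] by simp
  have dq: "length q - 1 \<le> Polynomial.degree K"
  proof -
    have "length q \<le> length (l K)" unfolding q_def by (rule L.normalize_length_le)
    also have "\<dots> = length (coeffs K)" by (simp add: l_def)
    also have "\<dots> \<le> Suc (Polynomial.degree K)" by (simp add: coeffs_def)
    finally show ?thesis by simp
  qed
  have q0: "q \<noteq> []"
  proof
    assume "q = []"
    then have "\<forall>x\<in>set (l K). x = \<zero>\<^bsub>Fp_bar p\<^esub>"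
      unfolding q_def using L.normalize_def'(1)[of "l K"] by (metis append_Nil2 drop_all in_set_replicate list.size(3) minus_nat.diff_0 le_refl)
    then have z: "?c (Polynomial.coeff K i) = \<zero>\<^bsub>Fp_bar p\<^esub>" if "i \<le> Polynomial.degree K" "K \<noteq> 0" for i
      using that by (auto simp: l_def coeffs_def simp del: upt_Suc)
    have "int p dvd Polynomial.coeff K i" for i
    proof (cases "i \<le> Polynomial.degree K \<and> K \<noteq> 0")
      case True
      then have "eval_Fp_bar p [:Polynomial.coeff K i:] \<one>\<^bsub>Fp_bar p\<^esub> = \<zero>\<^bsub>Fp_bar p\<^esub>"
        using z eval_Fp_bar_const[OF p L.one_closed] by simp
      then show ?thesis by (rule eval_Fp_bar_const_eq_0D[OF p L.one_closed])
    next
      case False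
      then show ?thesis by (auto simp: coeff_eq_0)
    qed
    with K show False by (simp add: const_poly_dvd_iff)
  qed
  have Z: "?Z = set_mset (L.roots q)"
    using L.roots_mem_iff_is_root[OF qc] eq q0 unfolding L.is_root_def by auto
  show "finite ?Z" unfolding Z by simp
  have "card ?Z \<le> size (L.roots q)" unfolding Z 
    unfolding size_multiset_overloaded_eq card_eq_sum by (intro sum_mono) (simp add: Suc_le_eq)
  also have "\<dots> \<le> length q - 1" by (rule L.size_roots_le_degree[OF qc])
  finally show "card ?Z \<le> Polynomial.degree K" using dq by simp
qed

text \<open>\<open>ord\<close> is 0 on elements of infinite order, which would then count as a small
  order. This does not occur: \<open>v\<close> is algebraic over the finite prime field, so its
  powers lie in a finite simple extension.\<close>

lemma finite_order_Fp_bar: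
  assumes v: "v \<in> carrier (Fp_bar p)" "v \<noteq> \<zero>\<^bsub>Fp_bar p\<^esub>"
  shows "group.ord (mult_of (Fp_bar p)) v \<noteq> 0"
proof
  let ?F = "residue_ring (int p)"
  let ?K = "ring.indexed_const ?F ` carrier ?F"
  interpret F: field ?F using p by (intro residues_prime.is_field) (unfold_locales, simp_all)
  interpret G: group "mult_of (Fp_bar p)" 
    using L.field_mult_group by (simp add: Multiplicative_Group.mult_of_def Ring_Divisibility.mult_of_def)
  interpret C: algebraic_closure "Fp_bar p" ?K
    unfolding Fp_bar_def by (rule F.alg_closureE(1))
  assume ord: "group.ord (mult_of (Fp_bar p)) v = 0"
  have sK: "subfield ?K (Fp_bar p)" by (rule C.subfield_axioms)
  have "finite (carrier ?F)" by (simp add: residue_ring_def)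
  then have fK: "finite ?K" by simp
  define E where "E = L.simple_extension ?K v"
  have "L.finite_dimension ?K E"
    unfolding E_def using L.finite_dimension_simple_extension[OF sK v(1)] C.algebraic_extension[OF v(1)] by simp
  then obtain n where "L.dimension n ?K E" by blast
  then obtain Us where Us: "set Us \<subseteq> carrier (Fp_bar p)" "L.Span ?K Us = E"
    using L.exists_base[OF sK] by blast
  have "finite {L.combine Ks Us | Ks. length Ks = length Us \<and> set Ks \<subseteq> ?K}"
    using finite_lists_length_eq[OF fK, of "length Us"]
    by (rule_tac finite_subset[OF _ finite_imageI[where h = "\<lambda>Ks. L.combine Ks Us"]]) auto
  then have fE: "finite E"
    using L.Span_eq_combine_set_length_version[OF sK Us(1)] Us(2) by simp
  have sE: "subring E (Fp_bar p)"
    unfolding E_def by (rule L.simple_extension_is_subring[OF subfieldE(1)[OF sK] v(1)])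
  have vE: "v \<in> E" unfolding E_def by (rule L.simple_extension_mem[OF subfieldE(1)[OF sK] v(1)])
  have pw: "v [^]\<^bsub>Fp_bar p\<^esub> (n::nat) \<in> E" for n
  proof (induction n)
    case 0
    then show ?case using subringE(3)[OF sE] by simp
  next
    case (Suc n)
    then show ?case using subringE(6)[OF sE] vE by simp
  qed
  have vm: "v \<in> carrier (mult_of (Fp_bar p))" using v by simp
  have "inj (\<lambda>n::nat. v [^]\<^bsub>Fp_bar p\<^esub> n)"
    using G.infinite_cyclic_subgroup[OF vm] G.infinite_cyclic_subgroup_order[OF vm] ord
    unfolding nat_pow_mult_of inj_def by blast
  then have "infinite (range (\<lambda>n::nat. v [^]\<^bsub>Fp_bar p\<^esub> n))" by (simp add: range_inj_infinite)
  moreover have "range (\<lambda>n::nat. v [^]\<^bsub>Fp_bar p\<^esub> n) \<subseteq> E" using pw by blast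
  ultimately show False using fE finite_subset by blast
qed

end

section \<open>Computability of the bound\<close>

lemma recursive_fun_Suc:
  assumes "recursive_fun k f"
  shows "recursive_fun k (\<lambda>xs. Suc (f xs))"
  using recursive_fun.comp[of "[f]" "\<lambda>xs. Suc (xs ! 0)" k] assms recursive_fun.succ by simp

lemma recursive_fun_const: "recursive_fun k (\<lambda>xs. c)"
  by (induction c) (auto intro: recursive_fun.zero recursive_fun_Suc)

lemma recursive_fun_comp2:
  assumes "recursive_fun 2 f" "recursive_fun k g" "recursive_fun k h"
  shows "recursive_fun k (\<lambda>xs. f [g xs, h xs])"
  using recursive_fun.comp[of "[g, h]" f k] assms by (simp add: numeral_2_eq_2)

lemma recursive_fun_add:
  assumes "recursive_fun k g" "recursive_fun k h"
  shows "recursive_fun k (\<lambda>xs. g xs + h xs)"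
proof -
  have "recursive_fun (Suc 1) (\<lambda>xs. rec_nat (tl xs ! 0) (\<lambda>n r. Suc ((n # r # tl xs) ! 1)) (hd xs))"
    by (rule recursive_fun.prec) (auto intro!: recursive_fun_Suc recursive_fun.proj)
  then have 1: "recursive_fun 2 (\<lambda>xs. rec_nat (tl xs ! 0) (\<lambda>n r. Suc r) (hd xs))" by (simp add: numeral_2_eq_2)
  have "rec_nat y (\<lambda>n r. Suc r) x = x + y" for x y :: nat by (induction x) auto
  with recursive_fun_comp2[OF 1 assms] show ?thesis by simp
qed

lemma recursive_fun_mult:
  assumes "recursive_fun k g" "recursive_fun k h"
  shows "recursive_fun k (\<lambda>xs. g xs * h xs)"
proof -
  have "recursive_fun (Suc 1) (\<lambda>xs. rec_nat 0 (\<lambda>n r. (n # r # tl xs) ! 1 + (n # r # tl xs) ! 2) (hd xs))"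
    by (rule recursive_fun.prec) (auto intro!: recursive_fun.zero recursive_fun_add recursive_fun.proj)
  then have 1: "recursive_fun 2 (\<lambda>xs. rec_nat 0 (\<lambda>n r. r + tl xs ! 0) (hd xs))" by (simp add: numeral_2_eq_2)
  have "rec_nat 0 (\<lambda>n r. r + y) x = x * y" for x y :: nat by (induction x) auto
  with recursive_fun_comp2[OF 1 assms] show ?thesis by simp
qed

lemma recursive_fun_power:
  assumes "recursive_fun k g" "recursive_fun k h"
  shows "recursive_fun k (\<lambda>xs. g xs ^ h xs)"
proof -
  have "recursive_fun (Suc 1) (\<lambda>xs. rec_nat 1 (\<lambda>n r. (n # r # tl xs) ! 1 * (n # r # tl xs) ! 2) (hd xs))"
    by (rule recursive_fun.prec) (auto intro!: recursive_fun_const recursive_fun_mult recursive_fun.proj)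
  then have 1: "recursive_fun 2 (\<lambda>xs. rec_nat 1 (\<lambda>n r. r * tl xs ! 0) (hd xs))" by (simp add: numeral_2_eq_2)
  have "rec_nat 1 (\<lambda>n r. r * y) x = y ^ x" for x y :: nat by (induction x) auto
  \<comment> \<open>The recursion runs over the exponent, which is therefore passed first.\<close>
  with recursive_fun_comp2[OF 1 assms(2,1)] show ?thesis by simp
qed

text \<open>The code \<open>n\<close> of the tuple is at least its length and at least every degree
  in it. So \<open>n * n\<close> bounds the number of pairs of functions and
  \<open>torsion_bound n\<close> the degree of each \<open>K\<close>, and nothing has to be decoded
  to compute the bound.\<close>

definition exceptional_bound :: "ratfun list \<Rightarrow> nat" where
  "exceptional_bound fs = (let n = list_encode (map ratfun_code fs) in n * n * torsion_bound n)"

lemma effectively_computable_exceptional_bound: "effectively_computable exceptional_bound"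
proof -
  have "recursive_fun 1 (\<lambda>xs. xs ! 0 * xs ! 0 * torsion_bound (xs ! 0))"
    unfolding torsion_bound_def
    by (intro recursive_fun_mult recursive_fun_power recursive_fun_add recursive_fun_const recursive_fun.proj) auto
  then show ?thesis
    unfolding effectively_computable_def exceptional_bound_def Let_def by force
qed

lemma effectively_computable_const: "effectively_computable (\<lambda>fs. c)"
  unfolding effectively_computable_def using recursive_fun_const by blast

lemma length_le_list_encode: "length xs \<le> list_encode xs"
proof (induction xs)
  case (Cons x xs)
  then show ?case using le_prod_encode_2[of "list_encode xs" x] by simp
qed simp

lemma mem_le_list_encode: "x \<in> set xs \<Longrightarrow> x \<le> list_encode xs"
proof (induction xs)
  case (Cons y xs)
  then show ?case using le_prod_encode_1[of y "list_encode xs"] le_prod_encode_2[of "list_encode xs" y] by auto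
qed simp

lemma degree_le_poly_code: "Polynomial.degree P \<le> poly_code P"
proof -
  have "Polynomial.degree P \<le> length (map rat_code (coeffs P))" by (simp add: degree_eq_length_coeffs)
  also have "\<dots> \<le> poly_code P" unfolding poly_code_def by (rule length_le_list_encode)
  finally show ?thesis .
qed

lemma degree_le_code:
  assumes "f \<in> set fs"
  shows "Polynomial.degree (fst (quot_of_fract f)) \<le> list_encode (map ratfun_code fs)"
    and "Polynomial.degree (snd (quot_of_fract f)) \<le> list_encode (map ratfun_code fs)"
proof -
  have 1: "ratfun_code f \<le> list_encode (map ratfun_code fs)" using assms by (intro mem_le_list_encode) auto
  show "Polynomial.degree (fst (quot_of_fract f)) \<le> list_encode (map ratfun_code fs)"
    using 1 degree_le_poly_code le_prod_encode_1 unfolding ratfun_code_def by (meson order_trans)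
  show "Polynomial.degree (snd (quot_of_fract f)) \<le> list_encode (map ratfun_code fs)"
    using 1 degree_le_poly_code le_prod_encode_2 unfolding ratfun_code_def by (meson order_trans)
qed

section \<open>Exceptional points\<close>

context
  fixes p :: nat and a
  assumes p: "Factorial_Ring.prime p" and a: "a \<in> carrier (Fp_bar p)"
begin

interpretation L: field "Fp_bar p" by (rule Fp_bar_field(1)[OF p])

lemma has_value_closed:
  assumes "has_value p f a v"
  shows "v \<in> carrier (Fp_bar p)"
proof -
  obtain U V where *: "eval_Fp_bar p V a \<noteq> \<zero>\<^bsub>Fp_bar p\<^esub>"
    "v = eval_Fp_bar p U a \<otimes>\<^bsub>Fp_bar p\<^esub> inv\<^bsub>Fp_bar p\<^esub> (eval_Fp_bar p V a)"
    using assms unfolding has_value_def by blast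
  have "eval_Fp_bar p V a \<in> Units (Fp_bar p)" using *(1) eval_Fp_bar_closed[OF p a] L.field_Units by auto
  then show ?thesis unfolding *(2) using eval_Fp_bar_closed[OF p a] by simp
qed

text \<open>The value may come from a representative \<open>U / V\<close> other than
  \<open>P / Q\<close>, and \<open>Q\<close> may vanish at \<open>a\<close>, hence the product form.
  After multiplication by \<open>B\<close>, \<open>U * Q\<close> and \<open>P * V\<close> agree
  modulo \<open>p\<close>; \<open>B\<close> cancels because \<open>[:int p:]\<close> is a prime
  element not dividing it.\<close>

lemma has_value_int_polys:
  assumes f: "f = int_poly_to_ratfun P / int_poly_to_ratfun Q" "Q \<noteq> 0" and v: "has_value p f a v"
  shows "eval_Fp_bar p P a = v \<otimes>\<^bsub>Fp_bar p\<^esub> eval_Fp_bar p Q a"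
proof -
  let ?e = "\<lambda>U. eval_Fp_bar p U a"
  obtain U V A B where *: "\<not> [:int p:] dvd B" "f = int_poly_to_ratfun A / int_poly_to_ratfun B"
    "[:int p:] dvd (U * B - A * V)" "?e V \<noteq> \<zero>\<^bsub>Fp_bar p\<^esub>"
    "v = ?e U \<otimes>\<^bsub>Fp_bar p\<^esub> inv\<^bsub>Fp_bar p\<^esub> (?e V)"
    using v unfolding has_value_def reduces_to_def by blast
  have B0: "B \<noteq> 0" using *(1) by auto
  have "int_poly_to_ratfun A * int_poly_to_ratfun Q = int_poly_to_ratfun P * int_poly_to_ratfun B"
    using *(2) f B0 by (simp add: frac_eq_eq)
  then have "int_poly_to_ratfun (A * Q - P * B) = 0"
    by (simp add: int_poly_to_ratfun_def hom_distribs)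
  then have AQ: "A * Q = P * B" by simp
  have "(U * Q - P * V) * B = (U * B - A * V) * Q + (A * Q - P * B) * V" by (simp add: algebra_simps)
  also have "\<dots> = (U * B - A * V) * Q" using AQ by simp
  finally have "[:int p:] dvd (U * Q - P * V) * B" using *(3) by (metis dvd_mult2)
  moreover have "prime_elem [:int p:]" unfolding prime_elem_const_poly_iff using p by simp
  ultimately have "[:int p:] dvd (U * Q - P * V)" using *(1) by (metis prime_elem_dvd_mult_iff)
  then have cross: "?e U \<otimes>\<^bsub>Fp_bar p\<^esub> ?e Q = ?e P \<otimes>\<^bsub>Fp_bar p\<^esub> ?e V"
    using eval_Fp_bar_cong[OF p a] eval_Fp_bar_mult[OF p a] by metis
  have VU: "?e V \<in> Units (Fp_bar p)" using *(4) eval_Fp_bar_closed[OF p a] L.field_Units by auto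
  let ?i = "inv\<^bsub>Fp_bar p\<^esub> (?e V)"
  have c: "?e U \<in> carrier (Fp_bar p)" "?e Q \<in> carrier (Fp_bar p)" "?e P \<in> carrier (Fp_bar p)"
    "?e V \<in> carrier (Fp_bar p)" "?i \<in> carrier (Fp_bar p)" using eval_Fp_bar_closed[OF p a] VU by simp_all
  have "v \<otimes>\<^bsub>Fp_bar p\<^esub> ?e Q = (?e U \<otimes>\<^bsub>Fp_bar p\<^esub> ?e Q) \<otimes>\<^bsub>Fp_bar p\<^esub> ?i"
    unfolding *(5) using c by (simp add: L.m_ac)
  also have "\<dots> = (?e P \<otimes>\<^bsub>Fp_bar p\<^esub> ?e V) \<otimes>\<^bsub>Fp_bar p\<^esub> ?i" by (simp only: cross)
  also have "\<dots> = ?e P" using c VU by (simp add: L.m_assoc)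
  finally show ?thesis ..
qed

lemma eval_Fp_bar_power:
  "eval_Fp_bar p (U ^ n) a = eval_Fp_bar p U a [^]\<^bsub>Fp_bar p\<^esub> n"
  by (induction n) (use eval_Fp_bar_closed[OF p a] in
    \<open>simp_all add: eval_Fp_bar_1[OF p a] eval_Fp_bar_mult[OF p a] L.m_comm\<close>)

lemma eval_Fp_bar_root_of_unity_value:
  assumes "f = int_poly_to_ratfun P / int_poly_to_ratfun Q" "Q \<noteq> 0" and v: "has_value p f a v"
    and s: "v [^]\<^bsub>Fp_bar p\<^esub> (s::nat) = \<one>\<^bsub>Fp_bar p\<^esub>"
  shows "eval_Fp_bar p (P ^ s - Q ^ s) a = \<zero>\<^bsub>Fp_bar p\<^esub>"
proof -
  let ?e = "\<lambda>U. eval_Fp_bar p U a"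
  have "?e (P ^ s) = ?e (Q ^ s)"
    unfolding eval_Fp_bar_power has_value_int_polys[OF assms(1-3)]
    using eval_Fp_bar_closed[OF p a] has_value_closed[OF v] s by (simp add: L.nat_pow_distrib)
  moreover have "?e (P ^ s) = ?e (P ^ s - Q ^ s) \<oplus>\<^bsub>Fp_bar p\<^esub> ?e (Q ^ s)"
    using eval_Fp_bar_add[OF p a, of "P ^ s - Q ^ s" "Q ^ s"] by simp
  ultimately show ?thesis
    using eval_Fp_bar_closed[OF p a] by (metis L.add.r_cancel_one')
qed

end

section \<open>Counting bad primes and exceptional points\<close>

lemma power_diff_coeff_degree_bounds:
  fixes P Q :: "int poly"
  assumes h: "(\<Sum>i\<le>Polynomial.degree P. \<bar>Polynomial.coeff P i\<bar>) \<le> 2 ^ h"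
      "(\<Sum>i\<le>Polynomial.degree Q. \<bar>Polynomial.coeff Q i\<bar>) \<le> 2 ^ h"
    and d: "Polynomial.degree P \<le> d" "Polynomial.degree Q \<le> d" and s: "s \<le> \<tau>"
  shows "Polynomial.degree (P ^ s - Q ^ s) \<le> d * \<tau>"
    and "\<bar>Polynomial.coeff (P ^ s - Q ^ s) k\<bar> \<le> 2 ^ (h * \<tau> + 1)"
proof -
  have deg: "Polynomial.degree (A ^ s) \<le> d * \<tau>" if "Polynomial.degree A \<le> d" for A :: "int poly"
    using degree_power_le[of A s] mult_mono[OF that s] by (simp add: mult.commute)
  show "Polynomial.degree (P ^ s - Q ^ s) \<le> d * \<tau>" using deg d by (intro degree_diff_le) auto
  have cb: "\<bar>Polynomial.coeff (A ^ s) k\<bar> \<le> 2 ^ (h * \<tau>)"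
    if "(\<Sum>i\<le>Polynomial.degree A. \<bar>Polynomial.coeff A i\<bar>) \<le> 2 ^ h" for A :: "int poly"
  proof -
    have "\<bar>Polynomial.coeff (A ^ s) k\<bar> \<le> (\<Sum>i\<le>Polynomial.degree A. \<bar>Polynomial.coeff A i\<bar>) ^ s"
      by (rule coeff_power_bound)
    also have "\<dots> \<le> (2 ^ h) ^ s" using that by (intro power_mono) (auto intro: sum_nonneg)
    also have "\<dots> \<le> (2 ^ h) ^ \<tau>" using s by (intro power_increasing) auto
    finally show ?thesis by (simp add: power_mult)
  qed
  show "\<bar>Polynomial.coeff (P ^ s - Q ^ s) k\<bar> \<le> 2 ^ (h * \<tau> + 1)"
    using cb[OF h(1)] cb[OF h(2)] by simp
qed

text \<open>\<open>K\<close> and \<open>C\<close> are uniform in the orders \<open>s\<close> and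
  \<open>t\<close>; only \<open>r\<close> varies with them. Degrees and logarithms of coefficients
  of \<open>P ^ s - Q ^ s\<close> and \<open>R ^ t - W ^ t\<close> grow linearly in
  \<open>\<tau>\<close>, so \<open>r\<close> has \<open>O(\<tau> ^ 2)\<close> binary digits.\<close>

lemma bad_primes_of_pair:
  assumes ind: "mult_independent \<phi>" and nz: "0 \<notin> set \<phi>"
    and ij: "i < length \<phi>" "j < length \<phi>" "i \<noteq> j"
  shows "\<exists>K C. Polynomial.degree K \<le> torsion_bound (list_encode (map ratfun_code \<phi>)) \<and>
    (\<forall>p. Factorial_Ring.prime p \<longrightarrow> \<not> [:int p:] dvd K) \<and>
    (\<forall>s\<ge>1. \<forall>t\<ge>1. \<forall>\<tau>. s \<le> \<tau> \<longrightarrow> t \<le> \<tau> \<longrightarrow> (\<exists>r. r \<noteq> 0 \<and> \<bar>r\<bar> \<le> 2 ^ (C * \<tau> ^ 2) \<and>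
      (\<forall>p a v w. Factorial_Ring.prime p \<longrightarrow> \<not> int p dvd r \<longrightarrow> a \<in> carrier (Fp_bar p) \<longrightarrow>
        has_value p (\<phi> ! i) a v \<longrightarrow> has_value p (\<phi> ! j) a w \<longrightarrow>
        v [^]\<^bsub>Fp_bar p\<^esub> s = \<one>\<^bsub>Fp_bar p\<^esub> \<longrightarrow> w [^]\<^bsub>Fp_bar p\<^esub> t = \<one>\<^bsub>Fp_bar p\<^esub> \<longrightarrow>
        eval_Fp_bar p K a = \<zero>\<^bsub>Fp_bar p\<^esub>)))"
proof -
  define d where "d = list_encode (map ratfun_code \<phi>)"
  have mem: "\<phi> ! i \<in> set \<phi>" "\<phi> ! j \<in> set \<phi>" using ij by auto
  obtain P Q where PQ: "\<phi> ! i = int_poly_to_ratfun P / int_poly_to_ratfun Q" "Q \<noteq> 0"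
      "Polynomial.degree P \<le> d" "Polynomial.degree Q \<le> d"
      "\<And>x::complex. \<not> (poly (of_int_poly P) x = 0 \<and> poly (of_int_poly Q) x = 0)"
    using ratfun_int_representation[of "\<phi> ! i"] degree_le_code[OF mem(1)] unfolding d_def by metis
  obtain R W where RW: "\<phi> ! j = int_poly_to_ratfun R / int_poly_to_ratfun W" "W \<noteq> 0"
      "Polynomial.degree R \<le> d" "Polynomial.degree W \<le> d"
      "\<And>x::complex. \<not> (poly (of_int_poly R) x = 0 \<and> poly (of_int_poly W) x = 0)"
    using ratfun_int_representation[of "\<phi> ! j"] degree_le_code[OF mem(2)] unfolding d_def by metis
  have n0: "\<phi> ! i \<noteq> 0" "\<phi> ! j \<noteq> 0" using nz mem by auto
  have "int_poly_to_ratfun P \<noteq> 0" "int_poly_to_ratfun R \<noteq> 0" using n0 PQ(1) RW(1) by auto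
  then have PR0: "P \<noteq> 0" "R \<noteq> 0" by auto
  have indep: "a = a' \<and> b = b'" if "P ^ a * Q ^ a' * R ^ b * W ^ b' = Q ^ a * P ^ a' * W ^ b * R ^ b'" for a a' b b'
    by (rule mult_independent_int_polys[OF ind ij PQ(1) RW(1) PR0(1) PQ(2) PR0(2) RW(2) that])
  obtain K0 where K0: "K0 \<noteq> 0" "Polynomial.degree K0 \<le> torsion_bound d"
    "\<And>(x::complex) s t. s > 0 \<Longrightarrow> t > 0 \<Longrightarrow>
      poly (of_int_poly P) x \<noteq> 0 \<Longrightarrow> poly (of_int_poly R) x \<noteq> 0 \<Longrightarrow>
      poly (of_int_poly P) x ^ s = poly (of_int_poly Q) x ^ s \<Longrightarrow>
      poly (of_int_poly R) x ^ t = poly (of_int_poly W) x ^ t \<Longrightarrow>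
      poly (of_int_poly K0) x = 0"
    using torsion_cover_pair[OF PR0(1) PQ(2) PR0(2) RW(2) PQ(3,4) RW(3,4) indep] by blast
  \<comment> \<open>A primitive polynomial is non-zero modulo every prime, and removing the content
    changes neither the degree nor the complex zeros.\<close>
  define K where "K = primitive_part K0"
  have K0K: "K0 = Polynomial.smult (content K0) K" by (simp add: K_def)
  have "Polynomial.degree K \<le> torsion_bound d" using K0(2) by (simp add: K_def)
  moreover have "\<not> [:int p:] dvd K" if "Factorial_Ring.prime p" for p
  proof
    assume "[:int p:] dvd K"
    then have "int p dvd content K" by (simp add: const_poly_dvd_iff_dvd_content)
    then have "int p dvd 1" using K0(1) by (simp add: K_def)
    then show False using that by (simp add: prime_nat_iff)
  qed
  moreover have "\<exists>C. \<forall>s\<ge>1. \<forall>t\<ge>1. \<forall>\<tau>. s \<le> \<tau> \<longrightarrow> t \<le> \<tau> \<longrightarrow> (\<exists>r. r \<noteq> 0 \<and> \<bar>r\<bar> \<le> 2 ^ (C * \<tau> ^ 2) \<and>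
      (\<forall>p a v w. Factorial_Ring.prime p \<longrightarrow> \<not> int p dvd r \<longrightarrow> a \<in> carrier (Fp_bar p) \<longrightarrow>
        has_value p (\<phi> ! i) a v \<longrightarrow> has_value p (\<phi> ! j) a w \<longrightarrow>
        v [^]\<^bsub>Fp_bar p\<^esub> s = \<one>\<^bsub>Fp_bar p\<^esub> \<longrightarrow> w [^]\<^bsub>Fp_bar p\<^esub> t = \<one>\<^bsub>Fp_bar p\<^esub> \<longrightarrow>
        eval_Fp_bar p K a = \<zero>\<^bsub>Fp_bar p\<^esub>))"
  proof -
    let ?n = "\<lambda>A::int poly. \<Sum>i\<le>Polynomial.degree A. \<bar>Polynomial.coeff A i\<bar>"
    define h where "h = nat (?n P + ?n Q + ?n R + ?n W)"
    have npos: "?n A \<ge> 0" for A by (intro sum_nonneg) auto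
    have "int h \<le> 2 ^ h" using of_nat_le_iff[of h "2 ^ h", where 'a = int] less_imp_le[OF less_exp[of h]] by simp
    moreover have "?n P \<le> int h" "?n Q \<le> int h" "?n R \<le> int h" "?n W \<le> int h"
      using npos[of P] npos[of Q] npos[of R] npos[of W] by (simp_all add: h_def)
    ultimately have nh: "?n P \<le> 2 ^ h" "?n Q \<le> 2 ^ h" "?n R \<le> 2 ^ h" "?n W \<le> 2 ^ h" by linarith+
    \<comment> \<open>The exponent in \<open>common_zeros_mod_primes\<close> for degree
      \<open>d * \<tau>\<close> and coefficients up to \<open>2 ^ (h * \<tau> + 1)\<close>, with
      lower powers of \<open>\<tau> \<ge> 1\<close> estimated by \<open>\<tau> ^ 2\<close>.\<close>
    define C where "C = (3 * d + h + 1) * (2 * d) + h + 1"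
    show ?thesis
    proof (intro exI[of _ C] allI impI)
      fix s t \<tau> :: nat
      assume st: "s \<ge> 1" "t \<ge> 1" "s \<le> \<tau>" "t \<le> \<tau>"
      let ?A = "P ^ s - Q ^ s" and ?B = "R ^ t - W ^ t"
      have A0: "?A \<noteq> 0" using indep[of s 0 0 0] st by auto
      have B0: "?B \<noteq> 0" using indep[of 0 0 t 0] st by auto
      have "\<exists>r. r \<noteq> 0 \<and> \<bar>r\<bar> \<le> 2 ^ ((3 * (d * \<tau>) + (h * \<tau> + 1)) * (2 * (d * \<tau>)) + (h * \<tau> + 1)) \<and>
        (\<forall>p a. Factorial_Ring.prime p \<longrightarrow> \<not> int p dvd r \<longrightarrow> a \<in> carrier (Fp_bar p) \<longrightarrow>
          eval_Fp_bar p ?A a = \<zero>\<^bsub>Fp_bar p\<^esub> \<longrightarrow> eval_Fp_bar p ?B a = \<zero>\<^bsub>Fp_bar p\<^esub> \<longrightarrow>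
          eval_Fp_bar p K a = \<zero>\<^bsub>Fp_bar p\<^esub>)"
      proof (rule common_zeros_mod_primes[OF A0 B0])
        show "Polynomial.degree ?A \<le> d * \<tau>" "\<bar>Polynomial.coeff ?A k\<bar> \<le> 2 ^ (h * \<tau> + 1)" for k
          using power_diff_coeff_degree_bounds[OF nh(1,2) PQ(3,4) st(3)] by blast+
        show "Polynomial.degree ?B \<le> d * \<tau>" "\<bar>Polynomial.coeff ?B k\<bar> \<le> 2 ^ (h * \<tau> + 1)" for k
          using power_diff_coeff_degree_bounds[OF nh(3,4) RW(3,4) st(4)] by blast+
        fix x :: complex
        assume "poly (of_int_poly ?A) x = 0" "poly (of_int_poly ?B) x = 0"
        then have eq: "poly (of_int_poly P) x ^ s = poly (of_int_poly Q) x ^ s"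
          "poly (of_int_poly R) x ^ t = poly (of_int_poly W) x ^ t" by (simp_all add: hom_distribs)
        \<comment> \<open>By \<open>eq\<close> and \<open>s \<ge> 1\<close>, a zero of
          \<open>P\<close> would also be one of \<open>Q\<close>, but the two have no common zero;
          likewise for \<open>R\<close> and \<open>W\<close>.\<close>
        have "poly (of_int_poly P) x \<noteq> 0" "poly (of_int_poly R) x \<noteq> 0"
          using eq st PQ(5)[of x] RW(5)[of x] by (auto simp: power_0_left)
        then have "poly (of_int_poly K0) x = 0" using eq st K0(3)[of s t x] by simp
        then have "of_int (content K0) * poly (of_int_poly K) x = 0"
          by (subst (asm) K0K) (simp add: hom_distribs)
        then show "poly (of_int_poly K) x = 0" using K0(1) by simp
      qed
      then obtain r where r: "r \<noteq> 0" "\<bar>r\<bar> \<le> 2 ^ ((3 * (d * \<tau>) + (h * \<tau> + 1)) * (2 * (d * \<tau>)) + (h * \<tau> + 1))"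
        "\<And>p a. Factorial_Ring.prime p \<Longrightarrow> \<not> int p dvd r \<Longrightarrow> a \<in> carrier (Fp_bar p) \<Longrightarrow>
          eval_Fp_bar p ?A a = \<zero>\<^bsub>Fp_bar p\<^esub> \<Longrightarrow> eval_Fp_bar p ?B a = \<zero>\<^bsub>Fp_bar p\<^esub> \<Longrightarrow>
          eval_Fp_bar p K a = \<zero>\<^bsub>Fp_bar p\<^esub>" by blast
      have "(3 * (d * \<tau>) + (h * \<tau> + 1)) * (2 * (d * \<tau>)) + (h * \<tau> + 1) \<le> C * \<tau> ^ 2"
      proof -
        have 1: "1 \<le> \<tau>" using st by simp
        have "\<tau> * 1 \<le> \<tau> * \<tau>" using 1 by (intro mult_le_mono) auto
        then have "h * \<tau> \<le> h * (\<tau> * \<tau>)" "1 \<le> \<tau> * \<tau>" using 1 by (auto intro: mult_le_mono2)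
        then have "h * \<tau> + 1 \<le> h * (\<tau> * \<tau>) + \<tau> * \<tau>" by (rule add_mono)
        then have 2: "h * \<tau> + 1 \<le> (h + 1) * \<tau> ^ 2" by (simp add: power2_eq_square algebra_simps)
        have "3 * (d * \<tau>) + (h * \<tau> + 1) \<le> (3 * d + h + 1) * \<tau>" using 1 by (simp add: algebra_simps)
        then have "(3 * (d * \<tau>) + (h * \<tau> + 1)) * (2 * (d * \<tau>)) \<le> ((3 * d + h + 1) * \<tau>) * (2 * (d * \<tau>))"
          by (rule mult_le_mono1)
        from add_mono[OF this 2] show ?thesis by (simp add: C_def power2_eq_square algebra_simps)
      qed
      then have "(2::int) ^ ((3 * (d * \<tau>) + (h * \<tau> + 1)) * (2 * (d * \<tau>)) + (h * \<tau> + 1)) \<le> 2 ^ (C * \<tau> ^ 2)"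
        by (intro power_increasing) auto
      with r(2) have rb: "\<bar>r\<bar> \<le> 2 ^ (C * \<tau> ^ 2)" by (rule order_trans)
      show "\<exists>r. r \<noteq> 0 \<and> \<bar>r\<bar> \<le> 2 ^ (C * \<tau> ^ 2) \<and>
        (\<forall>p a v w. Factorial_Ring.prime p \<longrightarrow> \<not> int p dvd r \<longrightarrow> a \<in> carrier (Fp_bar p) \<longrightarrow>
          has_value p (\<phi> ! i) a v \<longrightarrow> has_value p (\<phi> ! j) a w \<longrightarrow>
          v [^]\<^bsub>Fp_bar p\<^esub> s = \<one>\<^bsub>Fp_bar p\<^esub> \<longrightarrow> w [^]\<^bsub>Fp_bar p\<^esub> t = \<one>\<^bsub>Fp_bar p\<^esub> \<longrightarrow>
          eval_Fp_bar p K a = \<zero>\<^bsub>Fp_bar p\<^esub>)"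
        by (intro exI[of _ r] conjI allI impI r rb)
           (simp_all add: eval_Fp_bar_root_of_unity_value[OF _ _ PQ(1,2)] eval_Fp_bar_root_of_unity_value[OF _ _ RW(1,2)])
    qed
  qed
  ultimately show ?thesis unfolding d_def by blast
qed

text \<open>Fewer than \<open>m - 1\<close> large orders leave at least two indices with small
  order. By \<open>finite_order_Fp_bar\<close> these orders are positive, so they can serve as the
  exponents \<open>s\<close> and \<open>t\<close>.\<close>

lemma exceptional_pointD:
  assumes p: "Factorial_Ring.prime p" and E: "a \<in> exceptional_points p \<phi> T"
  shows "\<exists>i<length \<phi>. \<exists>j<length \<phi>. i \<noteq> j \<and>
    (\<exists>s\<ge>1. \<exists>t\<ge>1. \<exists>v w. real s < T \<and> real t < T \<and> has_value p (\<phi> ! i) a v \<and> has_value p (\<phi> ! j) a w \<and>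
      v [^]\<^bsub>Fp_bar p\<^esub> s = \<one>\<^bsub>Fp_bar p\<^esub> \<and> w [^]\<^bsub>Fp_bar p\<^esub> t = \<one>\<^bsub>Fp_bar p\<^esub>)"
proof -
  have a: "a \<in> carrier (Fp_bar p)" and val: "\<And>f. f \<in> set \<phi> \<Longrightarrow> neither_zero_nor_pole p f a"
    and card: "card {i. i < length \<phi> \<and> real (value_order p (\<phi> ! i) a) \<ge> T} < length \<phi> - 1"
    using E by (auto simp: exceptional_points_def)
  interpret L: field "Fp_bar p" by (rule Fp_bar_field(1)[OF p])
  interpret G: group "mult_of (Fp_bar p)"
    using L.field_mult_group by (simp add: Multiplicative_Group.mult_of_def Ring_Divisibility.mult_of_def)
  let ?B = "{i. i < length \<phi> \<and> real (value_order p (\<phi> ! i) a) \<ge> T}"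
  let ?S = "{..<length \<phi>} - ?B"
  have "card ?S = length \<phi> - card ?B" by (subst card_Diff_subset) auto
  then have "\<not> card ?S \<le> Suc 0" using card by simp
  moreover have "finite ?S" by simp
  ultimately have "\<not> (\<forall>i\<in>?S. \<forall>j\<in>?S. i = j)" by (simp only: card_le_Suc0_iff_eq not_False_eq_True)
  then obtain i j where ij: "i \<in> ?S" "j \<in> ?S" "i \<noteq> j" by blast
  have *: "\<exists>s\<ge>1. \<exists>v. real s < T \<and> has_value p (\<phi> ! k) a v \<and> v [^]\<^bsub>Fp_bar p\<^esub> s = \<one>\<^bsub>Fp_bar p\<^esub>"
    if k: "k \<in> ?S" for k
  proof -
    have "\<phi> ! k \<in> set \<phi>" using k by auto
    then obtain v where v: "has_value p (\<phi> ! k) a v" "v \<noteq> \<zero>\<^bsub>Fp_bar p\<^esub>"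
      using val unfolding neither_zero_nor_pole_def by blast
    have "ratfun_value p (\<phi> ! k) a = v"
      unfolding ratfun_value_def using v(1) has_value_unique[OF p a] by (intro the_equality) auto
    then have ord: "value_order p (\<phi> ! k) a = G.ord v" by (simp add: value_order_def)
    have vc: "v \<in> carrier (mult_of (Fp_bar p))" using has_value_closed[OF p a v(1)] v(2) by simp
    have "G.ord v \<noteq> 0" using finite_order_Fp_bar[OF p] vc by simp
    moreover have "real (G.ord v) < T" using k ord by auto
    moreover have "v [^]\<^bsub>Fp_bar p\<^esub> G.ord v = \<one>\<^bsub>Fp_bar p\<^esub>"
      using G.pow_ord_eq_1[OF vc] by (simp add: Ring_Divisibility.nat_pow_mult_of)
    ultimately show ?thesis using v(1) by (intro exI[of _ "G.ord v"] conjI exI[of _ v]) auto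
  qed
  obtain s v where s: "s \<ge> 1" "real s < T" "has_value p (\<phi> ! i) a v" "v [^]\<^bsub>Fp_bar p\<^esub> s = \<one>\<^bsub>Fp_bar p\<^esub>"
    using *[OF ij(1)] by blast
  obtain t w where t: "t \<ge> 1" "real t < T" "has_value p (\<phi> ! j) a w" "w [^]\<^bsub>Fp_bar p\<^esub> t = \<one>\<^bsub>Fp_bar p\<^esub>"
    using *[OF ij(2)] by blast
  have "i < length \<phi>" "j < length \<phi>" using ij by simp_all
  with ij(3) s t show ?thesis by blast
qed

text \<open>A prime is bad if it divides \<open>r\<close> for some ordered pair of functions and
  some orders up to \<open>\<tau>\<close>. There are \<open>\<tau> ^ 2\<close> pairs of orders with
  \<open>O(\<tau> ^ 2)\<close> primes each, hence the fourth power. For any other prime the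
  exceptional points are zeros of the polynomials \<open>K q\<close>.\<close>

lemma few_bad_primes:
  assumes ind: "mult_independent \<phi>" and nz: "0 \<notin> set \<phi>"
  shows "\<exists>C. \<forall>T. \<exists>B. finite B \<and> card B \<le> C * nat \<lfloor>T\<rfloor> ^ 4 \<and>
    (\<forall>p. Factorial_Ring.prime p \<longrightarrow> p \<notin> B \<longrightarrow>
      finite (exceptional_points p \<phi> T) \<and> card (exceptional_points p \<phi> T) \<le> exceptional_bound \<phi>)"
proof -
  define d where "d = list_encode (map ratfun_code \<phi>)"
  define I where "I = {(i, j). i < length \<phi> \<and> j < length \<phi> \<and> i \<noteq> j}"
  have I: "I \<subseteq> {..<length \<phi>} \<times> {..<length \<phi>}" by (auto simp: I_def)
  then have fI: "finite I" by (rule finite_subset) simp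
  have cI: "card I \<le> d * d"
  proof -
    have "card I \<le> length \<phi> * length \<phi>" using card_mono[OF _ I] by simp
    also have "\<dots> \<le> d * d" using length_le_list_encode[of "map ratfun_code \<phi>"] by (intro mult_le_mono) (simp_all add: d_def)
    finally show ?thesis .
  qed
  have "\<forall>q\<in>I. \<exists>K C. Polynomial.degree K \<le> torsion_bound d \<and>
    (\<forall>p. Factorial_Ring.prime p \<longrightarrow> \<not> [:int p:] dvd K) \<and>
    (\<forall>s\<ge>1. \<forall>t\<ge>1. \<forall>\<tau>. s \<le> \<tau> \<longrightarrow> t \<le> \<tau> \<longrightarrow> (\<exists>r. r \<noteq> 0 \<and> \<bar>r\<bar> \<le> 2 ^ (C * \<tau> ^ 2) \<and>
      (\<forall>p a v w. Factorial_Ring.prime p \<longrightarrow> \<not> int p dvd r \<longrightarrow> a \<in> carrier (Fp_bar p) \<longrightarrow>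
        has_value p (\<phi> ! fst q) a v \<longrightarrow> has_value p (\<phi> ! snd q) a w \<longrightarrow>
        v [^]\<^bsub>Fp_bar p\<^esub> s = \<one>\<^bsub>Fp_bar p\<^esub> \<longrightarrow> w [^]\<^bsub>Fp_bar p\<^esub> t = \<one>\<^bsub>Fp_bar p\<^esub> \<longrightarrow>
        eval_Fp_bar p K a = \<zero>\<^bsub>Fp_bar p\<^esub>)))"
    unfolding d_def by (intro ballI bad_primes_of_pair[OF ind nz]) (auto simp: I_def)
  from bchoice[OF this] obtain K where "\<forall>q\<in>I. \<exists>C. Polynomial.degree (K q) \<le> torsion_bound d \<and>
    (\<forall>p. Factorial_Ring.prime p \<longrightarrow> \<not> [:int p:] dvd K q) \<and>
    (\<forall>s\<ge>1. \<forall>t\<ge>1. \<forall>\<tau>. s \<le> \<tau> \<longrightarrow> t \<le> \<tau> \<longrightarrow> (\<exists>r. r \<noteq> 0 \<and> \<bar>r\<bar> \<le> 2 ^ (C * \<tau> ^ 2) \<and>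
      (\<forall>p a v w. Factorial_Ring.prime p \<longrightarrow> \<not> int p dvd r \<longrightarrow> a \<in> carrier (Fp_bar p) \<longrightarrow>
        has_value p (\<phi> ! fst q) a v \<longrightarrow> has_value p (\<phi> ! snd q) a w \<longrightarrow>
        v [^]\<^bsub>Fp_bar p\<^esub> s = \<one>\<^bsub>Fp_bar p\<^esub> \<longrightarrow> w [^]\<^bsub>Fp_bar p\<^esub> t = \<one>\<^bsub>Fp_bar p\<^esub> \<longrightarrow>
        eval_Fp_bar p (K q) a = \<zero>\<^bsub>Fp_bar p\<^esub>)))" ..
  from bchoice[OF this] obtain C where "\<forall>q\<in>I. Polynomial.degree (K q) \<le> torsion_bound d \<and>
    (\<forall>p. Factorial_Ring.prime p \<longrightarrow> \<not> [:int p:] dvd K q) \<and>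
    (\<forall>s\<ge>1. \<forall>t\<ge>1. \<forall>\<tau>. s \<le> \<tau> \<longrightarrow> t \<le> \<tau> \<longrightarrow> (\<exists>r. r \<noteq> 0 \<and> \<bar>r\<bar> \<le> 2 ^ (C q * \<tau> ^ 2) \<and>
      (\<forall>p a v w. Factorial_Ring.prime p \<longrightarrow> \<not> int p dvd r \<longrightarrow> a \<in> carrier (Fp_bar p) \<longrightarrow>
        has_value p (\<phi> ! fst q) a v \<longrightarrow> has_value p (\<phi> ! snd q) a w \<longrightarrow>
        v [^]\<^bsub>Fp_bar p\<^esub> s = \<one>\<^bsub>Fp_bar p\<^esub> \<longrightarrow> w [^]\<^bsub>Fp_bar p\<^esub> t = \<one>\<^bsub>Fp_bar p\<^esub> \<longrightarrow>
        eval_Fp_bar p (K q) a = \<zero>\<^bsub>Fp_bar p\<^esub>)))" ..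
  then have K: "\<And>q. q \<in> I \<Longrightarrow> Polynomial.degree (K q) \<le> torsion_bound d"
      "\<And>q p. q \<in> I \<Longrightarrow> Factorial_Ring.prime p \<Longrightarrow> \<not> [:int p:] dvd K q"
    and C: "\<And>q s t \<tau>. q \<in> I \<Longrightarrow> s \<ge> 1 \<Longrightarrow> t \<ge> 1 \<Longrightarrow> s \<le> \<tau> \<Longrightarrow> t \<le> \<tau> \<Longrightarrow> \<exists>r. r \<noteq> 0 \<and> \<bar>r\<bar> \<le> 2 ^ (C q * \<tau> ^ 2) \<and>
      (\<forall>p a v w. Factorial_Ring.prime p \<longrightarrow> \<not> int p dvd r \<longrightarrow> a \<in> carrier (Fp_bar p) \<longrightarrow>
        has_value p (\<phi> ! fst q) a v \<longrightarrow> has_value p (\<phi> ! snd q) a w \<longrightarrow>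
        v [^]\<^bsub>Fp_bar p\<^esub> s = \<one>\<^bsub>Fp_bar p\<^esub> \<longrightarrow> w [^]\<^bsub>Fp_bar p\<^esub> t = \<one>\<^bsub>Fp_bar p\<^esub> \<longrightarrow>
        eval_Fp_bar p (K q) a = \<zero>\<^bsub>Fp_bar p\<^esub>)"
    by blast+
  have "\<exists>B. finite B \<and> card B \<le> (\<Sum>q\<in>I. C q) * nat \<lfloor>T\<rfloor> ^ 4 \<and>
    (\<forall>p. Factorial_Ring.prime p \<longrightarrow> p \<notin> B \<longrightarrow>
      finite (exceptional_points p \<phi> T) \<and> card (exceptional_points p \<phi> T) \<le> exceptional_bound \<phi>)" for T
  proof -
    \<comment> \<open>Orders are integers below \<open>T\<close>, hence at most its integer
      part.\<close>
    define \<tau> where "\<tau> = nat \<lfloor>T\<rfloor>"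
    let ?X = "\<lambda>q. {q} \<times> ({1..\<tau>} \<times> {1..\<tau>})"
    let ?J = "\<Union>q\<in>I. ?X q"
    have "\<forall>(q, s, t)\<in>?J. \<exists>r. r \<noteq> 0 \<and> \<bar>r\<bar> \<le> 2 ^ (C q * \<tau> ^ 2) \<and>
      (\<forall>p a v w. Factorial_Ring.prime p \<longrightarrow> \<not> int p dvd r \<longrightarrow> a \<in> carrier (Fp_bar p) \<longrightarrow>
        has_value p (\<phi> ! fst q) a v \<longrightarrow> has_value p (\<phi> ! snd q) a w \<longrightarrow>
        v [^]\<^bsub>Fp_bar p\<^esub> s = \<one>\<^bsub>Fp_bar p\<^esub> \<longrightarrow> w [^]\<^bsub>Fp_bar p\<^esub> t = \<one>\<^bsub>Fp_bar p\<^esub> \<longrightarrow>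
        eval_Fp_bar p (K q) a = \<zero>\<^bsub>Fp_bar p\<^esub>)"
    proof (clarify, goal_cases)
      case (1 q1 q2 s t)
      then show ?case by (intro C) auto
    qed
    then have "\<forall>x\<in>?J. \<exists>r. r \<noteq> 0 \<and> \<bar>r\<bar> \<le> 2 ^ (C (fst x) * \<tau> ^ 2) \<and>
      (\<forall>p a v w. Factorial_Ring.prime p \<longrightarrow> \<not> int p dvd r \<longrightarrow> a \<in> carrier (Fp_bar p) \<longrightarrow>
        has_value p (\<phi> ! fst (fst x)) a v \<longrightarrow> has_value p (\<phi> ! snd (fst x)) a w \<longrightarrow>
        v [^]\<^bsub>Fp_bar p\<^esub> fst (snd x) = \<one>\<^bsub>Fp_bar p\<^esub> \<longrightarrow> w [^]\<^bsub>Fp_bar p\<^esub> snd (snd x) = \<one>\<^bsub>Fp_bar p\<^esub> \<longrightarrow>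
        eval_Fp_bar p (K (fst x)) a = \<zero>\<^bsub>Fp_bar p\<^esub>)" by (simp only: case_prod_unfold)
    from bchoice[OF this] obtain r where r0: "\<forall>x\<in>?J. r x \<noteq> 0 \<and> \<bar>r x\<bar> \<le> 2 ^ (C (fst x) * \<tau> ^ 2) \<and>
      (\<forall>p a v w. Factorial_Ring.prime p \<longrightarrow> \<not> int p dvd r x \<longrightarrow> a \<in> carrier (Fp_bar p) \<longrightarrow>
        has_value p (\<phi> ! fst (fst x)) a v \<longrightarrow> has_value p (\<phi> ! snd (fst x)) a w \<longrightarrow>
        v [^]\<^bsub>Fp_bar p\<^esub> fst (snd x) = \<one>\<^bsub>Fp_bar p\<^esub> \<longrightarrow> w [^]\<^bsub>Fp_bar p\<^esub> snd (snd x) = \<one>\<^bsub>Fp_bar p\<^esub> \<longrightarrow>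
        eval_Fp_bar p (K (fst x)) a = \<zero>\<^bsub>Fp_bar p\<^esub>)" ..
    note r = r0[rule_format, THEN conjunct1] r0[rule_format, THEN conjunct2, THEN conjunct1]
      r0[rule_format, THEN conjunct2, THEN conjunct2, rule_format]
    let ?P = "\<lambda>x. {p::nat. Factorial_Ring.prime p \<and> int p dvd r x}"
    define B where "B = (\<Union>q\<in>I. \<Union>x\<in>?X q. ?P x)"
    have fB: "finite B"
      unfolding B_def using fI by (intro finite_UN_I card_prime_divisors_le(1)[OF r(1,2)]) auto
    have "card B \<le> (\<Sum>q\<in>I. card (\<Union>x\<in>?X q. ?P x))" unfolding B_def by (rule card_UN_le[OF fI])
    also have "\<dots> \<le> (\<Sum>q\<in>I. C q * \<tau> ^ 4)"
    proof (intro sum_mono)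
      fix q assume q: "q \<in> I"
      have "card (\<Union>x\<in>?X q. ?P x) \<le> (\<Sum>x\<in>?X q. card (?P x))" by (rule card_UN_le) simp
      also have "\<dots> \<le> (\<Sum>x\<in>?X q. C q * \<tau> ^ 2)"
      proof (intro sum_mono)
        fix x assume x: "x \<in> ?X q"
        then have "x \<in> ?J" "fst x = q" using q by auto
        then show "card (?P x) \<le> C q * \<tau> ^ 2" using r(1,2)[of x] by (intro card_prime_divisors_le(2)) auto
      qed
      also have "\<dots> = C q * \<tau> ^ 4" by (simp add: card_cartesian_product power4_eq_xxxx power2_eq_square)
      finally show "card (\<Union>x\<in>?X q. ?P x) \<le> C q * \<tau> ^ 4" .
    qed
    finally have cB: "card B \<le> (\<Sum>q\<in>I. C q) * \<tau> ^ 4" by (simp add: sum_distrib_right)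
    have "finite (exceptional_points p \<phi> T) \<and> card (exceptional_points p \<phi> T) \<le> exceptional_bound \<phi>"
      if p: "Factorial_Ring.prime p" "p \<notin> B" for p
    proof -
      let ?Z = "\<lambda>q. {a \<in> carrier (Fp_bar p). eval_Fp_bar p (K q) a = \<zero>\<^bsub>Fp_bar p\<^esub>}"
      have sub: "exceptional_points p \<phi> T \<subseteq> (\<Union>q\<in>I. ?Z q)"
      proof
        fix a assume E: "a \<in> exceptional_points p \<phi> T"
        then have a: "a \<in> carrier (Fp_bar p)" by (simp add: exceptional_points_def)
        obtain i j s t v w where *: "i < length \<phi>" "j < length \<phi>" "i \<noteq> j" "s \<ge> 1" "t \<ge> 1" "real s < T" "real t < T"
          "has_value p (\<phi> ! i) a v" "has_value p (\<phi> ! j) a w"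
          "v [^]\<^bsub>Fp_bar p\<^esub> s = \<one>\<^bsub>Fp_bar p\<^esub>" "w [^]\<^bsub>Fp_bar p\<^esub> t = \<one>\<^bsub>Fp_bar p\<^esub>"
          using exceptional_pointD[OF p(1) E] by blast
        have st: "s \<le> \<tau>" "t \<le> \<tau>" using *(6,7) by (simp_all add: \<tau>_def le_nat_floor)
        let ?x = "((i, j), s, t)"
        have q: "(i, j) \<in> I" using * by (simp add: I_def)
        have x: "?x \<in> ?X (i, j)" using * st by simp
        then have xJ: "?x \<in> ?J" using q by blast
        have "\<not> int p dvd r ?x" using p q x unfolding B_def by blast
        then have "eval_Fp_bar p (K (i, j)) a = \<zero>\<^bsub>Fp_bar p\<^esub>"
          using r(3)[OF xJ p(1) _ a, of v w] * by simp
        then show "a \<in> (\<Union>q\<in>I. ?Z q)" using q a by blast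
      qed
      have fZ: "finite (?Z q)" if "q \<in> I" for q using card_zeros_Fp_bar(1)[OF p(1) K(2)[OF that p(1)]] .
      have fU: "finite (\<Union>q\<in>I. ?Z q)" using fI fZ by (rule finite_UN_I)
      have "card (exceptional_points p \<phi> T) \<le> card (\<Union>q\<in>I. ?Z q)" using fU sub by (rule card_mono)
      also have "\<dots> \<le> (\<Sum>q\<in>I. card (?Z q))" by (rule card_UN_le[OF fI])
      also have "\<dots> \<le> (\<Sum>q\<in>I. torsion_bound d)"
        by (intro sum_mono order_trans[OF card_zeros_Fp_bar(2)[OF p(1) K(2)[OF _ p(1)]] K(1)])
      also have "\<dots> \<le> d * d * torsion_bound d" using cI by simp
      finally show ?thesis using finite_subset[OF sub fU] by (simp add: exceptional_bound_def d_def Let_def)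
    qed
    with fB cB show ?thesis unfolding \<tau>_def by blast
  qed
  then show ?thesis by blast
qed

text \<open>As \<open>m \<ge> 2\<close>, the exponent \<open>4 / (2 * m + 2)\<close> is at most
  \<open>2 / 3\<close>, and \<open>(N / ln N) powr (2 / 3)\<close> is of smaller order than
  \<open>N / (ln N) ^ 2\<close>, so that any constant \<open>C\<close> is absorbed for large
  \<open>N\<close>.\<close>

lemma eventually_fourth_power_bound:
  fixes C m :: nat
  assumes m: "m \<ge> 2"
  shows "\<forall>\<^sub>F N :: nat in at_top.
    real (C * nat \<lfloor>(real N / ln (real N)) powr (1 / real (2 * m + 2))\<rfloor> ^ 4) \<le> real N / (ln (real N))\<^sup>2"
proof -
  have "((\<lambda>N::nat. (real N / ln (real N)) powr (2 / 3) / (real N / (ln (real N))\<^sup>2)) \<longlongrightarrow> 0) at_top" by real_asymp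
  then have "\<forall>\<^sub>F N :: nat in at_top. (real N / ln (real N)) powr (2 / 3) / (real N / (ln (real N))\<^sup>2) < 1 / (real C + 1)"
    by (rule order_tendstoD) simp
  moreover have "\<forall>\<^sub>F N :: nat in at_top. real N / ln (real N) \<ge> 1" by real_asymp
  moreover have "\<forall>\<^sub>F N :: nat in at_top. real N / (ln (real N))\<^sup>2 > 0" by real_asymp
  ultimately show ?thesis
  proof eventually_elim
    case (elim N)
    let ?x = "real N / ln (real N)" and ?y = "real N / (ln (real N))\<^sup>2"
    let ?T = "?x powr (1 / real (2 * m + 2))"
    have "real (nat \<lfloor>?T\<rfloor>) \<le> ?T" by simp
    then have "real (nat \<lfloor>?T\<rfloor>) ^ 4 \<le> ?T ^ 4" by (rule power_mono) simp
    also have "?T ^ 4 = ?x powr (4 / real (2 * m + 2))"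
      using elim(2) by (simp add: powr_powr flip: powr_realpow')
    also have "\<dots> \<le> ?x powr (2 / 3)" using elim(2) m by (intro powr_mono) (auto simp: field_simps)
    also have "\<dots> \<le> ?y / (real C + 1)"
      using less_imp_le[OF elim(1)[unfolded pos_divide_less_eq[OF elim(3)]]] by (simp add: mult.commute)
    finally have "real C * real (nat \<lfloor>?T\<rfloor>) ^ 4 \<le> real C * (?y / (real C + 1))" by (rule mult_left_mono) simp
    also have "\<dots> = ?y * (real C / (real C + 1))" by simp
    also have "\<dots> \<le> ?y * 1" using elim(3) by (intro mult_left_mono) auto
    finally show ?case by simp
  qed
qed

theorem theorem2p4:
  shows "\<exists>c1 c2. effectively_computable c1 \<and> effectively_computable c2 \<and>
    (\<forall>\<phi> :: ratfun list. 0 \<notin> set \<phi> \<longrightarrow> mult_independent \<phi> \<longrightarrow>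
      (\<forall>\<^sub>F N :: nat in at_top.
        real (card {p. Factorial_Ring.prime p \<and> p \<le> N \<and> (\<forall>f\<in>set \<phi>. has_reduction p f) \<and>
            \<not> (let E = exceptional_points p \<phi>
                         ((real N / ln (real N)) powr (1 / real (2 * length \<phi> + 2)))
               in finite E \<and> card E \<le> c2 \<phi>)})
        \<le> real (c1 \<phi>) * real N / (ln (real N))\<^sup>2))"
proof (intro exI conjI allI impI)
  \<comment> \<open>The constant \<open>C\<close> of \<open>few_bad_primes\<close> is absorbed for
    large \<open>N\<close>, so \<open>c1\<close> can be 1.\<close>
  show "effectively_computable (\<lambda>_. 1)" by (rule effectively_computable_const)
  show "effectively_computable exceptional_bound" by (rule effectively_computable_exceptional_bound)
  fix \<phi> :: "ratfun list"
  assume nz: "0 \<notin> set \<phi>" and ind: "mult_independent \<phi>"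
  let ?T = "\<lambda>N. (real N / ln (real N)) powr (1 / real (2 * length \<phi> + 2))"
  let ?E = "\<lambda>N p. exceptional_points p \<phi> (?T N)"
  let ?S = "\<lambda>N. {p. Factorial_Ring.prime p \<and> p \<le> N \<and> (\<forall>f\<in>set \<phi>. has_reduction p f) \<and>
            \<not> (let E = ?E N p in finite E \<and> card E \<le> exceptional_bound \<phi>)}"
  show "\<forall>\<^sub>F N :: nat in at_top. real (card (?S N)) \<le> real 1 * real N / (ln (real N))\<^sup>2"
  proof (cases "length \<phi> \<ge> 2")
    case False
    \<comment> \<open>For at most one function \<open>length \<phi> - 1\<close> is 0 in the natural
      numbers, and no cardinality lies below it.\<close>
    then have "?E N p = {}" for N p by (auto simp: exceptional_points_def)
    then show ?thesis by simp
  next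
    case True
    obtain C where C: "\<And>T. \<exists>B. finite B \<and> card B \<le> C * nat \<lfloor>T\<rfloor> ^ 4 \<and>
      (\<forall>p. Factorial_Ring.prime p \<longrightarrow> p \<notin> B \<longrightarrow>
        finite (exceptional_points p \<phi> T) \<and> card (exceptional_points p \<phi> T) \<le> exceptional_bound \<phi>)"
      using few_bad_primes[OF ind nz] by blast
    show ?thesis using eventually_fourth_power_bound[OF True, of C]
    proof eventually_elim
      case (elim N)
      obtain B where B: "finite B" "card B \<le> C * nat \<lfloor>?T N\<rfloor> ^ 4"
        "\<And>p. Factorial_Ring.prime p \<Longrightarrow> p \<notin> B \<Longrightarrow> finite (?E N p) \<and> card (?E N p) \<le> exceptional_bound \<phi>"
        using C[of "?T N"] by blast
      have "?S N \<subseteq> B" using B(3) by (auto simp: Let_def)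
      then have "card (?S N) \<le> C * nat \<lfloor>?T N\<rfloor> ^ 4" using card_mono[OF B(1)] B(2) order_trans by blast
      then have "real (card (?S N)) \<le> real (C * nat \<lfloor>?T N\<rfloor> ^ 4)" by (simp only: of_nat_le_iff)
      also note elim
      finally show ?case by simp
    qed
  qed
qed

end
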